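(* Let $S$ be the $p\times p$ empirical covariance matrix (assumed positive definite) and $\widehat C$ the associated empirical correlation matrix, and let $\widehat B_{\widehat C}$ be a minimizer of $\Psi$ over $\{B_\lambda:\lambda\in A_{\widehat C}\}$, where $A_{\widehat C}=\{|\widehat C_{ij}|:1\le i<j\le p\}$. The computational complexity of $\widehat B_{\widehat C}$ is $O(p^4)$: given $S$, it can be computed with $O(p^4)$ elementary operations.
   Context: $S=(s_{ij})=\frac1n\sum_{l=1}^n(X^{(l)}-\overline X)(X^{(l)}-\overline X)^T$ is the empirical covariance matrix of a sample $X^{(1)},\dots,X^{(n)}$ in $\mathbb R^p$, with $\overline X=\frac1n\sum_lX^{(l)}$, and $\widehat C_{ij}=s_{ij}/\sqrt{s_{ii}s_{jj}}$. Elementary operations are unit-cost operations on reals (arithmetic, comparisons, square roots, logarithms) and on indices. For a partition $B$ of $\{1,\dots,p\}$ and a symmetric matrix $\Gamma$, $\Gamma_B$ has entries $\gamma_{ij}$ when $i,j$ are in the same element of $B$ and $0$ otherwise; $B(\Gamma)$ is the unique finest partition $B$ with $\Gamma=\Gamma_B$ (the connected components of the graph of nonzero entries). For $\lambda\in[0,1]$, $B_\lambda=B((\widehat C_{ij}\mathbf 1_{|\widehat C_{ij}|>\lambda})_{i,j\le p})$. For $\Gamma$ symmetric positive definite, $l_\Gamma=\frac1p(\log|\Gamma|+\mathrm{Tr}(\Gamma^{-1}S))$, $\mathrm{pen}(\Gamma)=\sum_{k=1}^Kp_k^2$ if $B(\Gamma)=\{B_1,\dots,B_K\}$ with $|B_k|=p_k$,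 $\Phi(\Gamma)=l_\Gamma+\kappa\,\mathrm{pen}(\Gamma)$ with a given $\kappa\ge0$ (in the paper $\kappa=1/(pn^\delta)$), and $\Psi(B)=\Phi(S_B)$. *)

theory Defs
  imports
    Complex_Main
    "HOL-Library.Disjoint_Sets"
    "HOL-Library.Landau_Symbols"
    "Jordan_Normal_Form.Determinant"
    "Jordan_Normal_Form.Gauss_Jordan_Elimination"
begin

section \<open>Covariance and correlation matrices\<close>

text \<open>Coordinates are numbered \<open>0, \<dots>, p - 1\<close> and observations \<open>1, \<dots>, n\<close>.\<close>

definition sample_mean :: "nat \<Rightarrow> nat \<Rightarrow> (nat \<Rightarrow> real vec) \<Rightarrow> real vec" where
  "sample_mean p n X = vec p (\<lambda>i. (\<Sum>l=1..n. X l $ i) / real n)"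

definition empirical_covariance :: "nat \<Rightarrow> nat \<Rightarrow> (nat \<Rightarrow> real vec) \<Rightarrow> real mat" where
  "empirical_covariance p n X =
     mat p p (\<lambda>(i, j). (\<Sum>l=1..n. (X l - sample_mean p n X) $ i * (X l - sample_mean p n X) $ j) / real n)"

definition correlation :: "real mat \<Rightarrow> real mat" where
  "correlation S = mat (dim_row S) (dim_col S)
     (\<lambda>(i, j). S $$ (i, j) / sqrt (S $$ (i, i) * S $$ (j, j)))"

definition positive_definite :: "real mat \<Rightarrow> bool" where
  "positive_definite A \<longleftrightarrow> square_mat A \<and> transpose_mat A = A \<and>
     (\<forall>v \<in> carrier_vec (dim_row A). v \<noteq> 0\<^sub>v (dim_row A) \<longrightarrow> v \<bullet> (A *\<^sub>v v) > 0)"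

definition trace :: "real mat \<Rightarrow> real" where
  "trace A = (\<Sum>i<dim_row A. A $$ (i, i))"


section \<open>Block structure of a matrix\<close>

definition block_restrict :: "real mat \<Rightarrow> nat set set \<Rightarrow> real mat" where
  "block_restrict \<Gamma> B = mat (dim_row \<Gamma>) (dim_col \<Gamma>)
     (\<lambda>(i, j). if \<exists>b\<in>B. i \<in> b \<and> j \<in> b then \<Gamma> $$ (i, j) else 0)"

definition is_finest_partition :: "real mat \<Rightarrow> nat set set \<Rightarrow> bool" where
  "is_finest_partition \<Gamma> B \<longleftrightarrow>
     partition_on {..<dim_row \<Gamma>} B \<and> \<Gamma> = block_restrict \<Gamma> B \<and>
     (\<forall>B'. partition_on {..<dim_row \<Gamma>} B' \<and> \<Gamma> = block_restrict \<Gamma> B' \<longrightarrow> refines {..<dim_row \<Gamma>} B B')"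

definition finest_partition :: "real mat \<Rightarrow> nat set set" where
  "finest_partition \<Gamma> = (THE B. is_finest_partition \<Gamma> B)"

lemma ex1_finest_partition:
  assumes "\<Gamma> \<in> carrier_mat p p"
  shows "\<exists>!B. is_finest_partition \<Gamma> B"
proof -
  define A where "A = {..<p}"
  define Q where "Q = {B. partition_on A B \<and> \<Gamma> = block_restrict \<Gamma> B}"
  have dim: "dim_row \<Gamma> = p" "dim_col \<Gamma> = p"
    using assms by auto
  have restrict_iff: "\<Gamma> = block_restrict \<Gamma> B \<longleftrightarrow>
      (\<forall>i<p. \<forall>j<p. \<Gamma> $$ (i, j) \<noteq> 0 \<longrightarrow> (\<exists>b\<in>B. i \<in> b \<and> j \<in> b))" for B
  proof
    assume eq: "\<Gamma> = block_restrict \<Gamma> B"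
    show "\<forall>i<p. \<forall>j<p. \<Gamma> $$ (i, j) \<noteq> 0 \<longrightarrow> (\<exists>b\<in>B. i \<in> b \<and> j \<in> b)"
    proof (intro allI impI)
      fix i j assume "i < p" "j < p" "\<Gamma> $$ (i, j) \<noteq> 0"
      moreover have "\<Gamma> $$ (i, j) = block_restrict \<Gamma> B $$ (i, j)"
        using eq by simp
      ultimately show "\<exists>b\<in>B. i \<in> b \<and> j \<in> b"
        unfolding block_restrict_def using dim by (auto split: if_splits)
    qed
  next
    assume "\<forall>i<p. \<forall>j<p. \<Gamma> $$ (i, j) \<noteq> 0 \<longrightarrow> (\<exists>b\<in>B. i \<in> b \<and> j \<in> b)"
    then show "\<Gamma> = block_restrict \<Gamma> B"
      unfolding block_restrict_def using dim by (intro eq_matI) auto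
  qed
  have part: "\<And>P. P \<in> Q \<Longrightarrow> partition_on A P"
    by (simp add: Q_def)
  have "(if p = 0 then {} else {A}) \<in> Q"
    by (auto simp: Q_def A_def partition_on_def restrict_iff)
  then have ne: "Q \<noteq> {}"
    by blast
  let ?R = "common_refinement Q"
  have R: "partition_on A ?R"
    by (rule partition_on_common_refinement[OF part ne])
  have "\<exists>b\<in>?R. i \<in> b \<and> j \<in> b" if "i < p" "j < p" "\<Gamma> $$ (i, j) \<noteq> 0" for i j
  proof -
    have "\<forall>P\<in>Q. \<exists>b\<in>P. i \<in> b \<and> j \<in> b"
      using that by (auto simp: Q_def restrict_iff)
    then obtain F where F: "\<And>P. P \<in> Q \<Longrightarrow> F P \<in> P \<and> i \<in> F P \<and> j \<in> F P"
      by metis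
    then have "\<Inter> (F ` Q) \<in> ?R"
      unfolding common_refinement by auto
    with F show ?thesis
      by blast
  qed
  then have "\<Gamma> = block_restrict \<Gamma> ?R"
    by (simp add: restrict_iff)
  moreover have "refines A ?R B" if "partition_on A B" "\<Gamma> = block_restrict \<Gamma> B" for B
    by (rule refines_common_refinement[OF part]) (use that in \<open>simp_all add: Q_def\<close>)
  ultimately have "is_finest_partition \<Gamma> ?R"
    using R dim unfolding is_finest_partition_def A_def by simp
  then show ?thesis
    unfolding is_finest_partition_def by (metis refines_asym)
qed

definition threshold_partition :: "real mat \<Rightarrow> real \<Rightarrow> nat set set" where
  "threshold_partition C \<mu> = finest_partition
     (mat (dim_row C) (dim_col C) (\<lambda>(i, j). if \<bar>C $$ (i, j)\<bar> > \<mu> then C $$ (i, j) else 0))"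

definition thresholds :: "real mat \<Rightarrow> real set" where
  "thresholds C = {\<bar>C $$ (i, j)\<bar> | i j. i < j \<and> j < dim_row C}"


section \<open>The penalised criterion\<close>

definition loss :: "real mat \<Rightarrow> real mat \<Rightarrow> real" where
  "loss S \<Gamma> = (ln (det \<Gamma>) + trace (the (mat_inverse \<Gamma>) * S)) / real (dim_row \<Gamma>)"

definition pen :: "real mat \<Rightarrow> nat" where
  "pen \<Gamma> = (\<Sum>b\<in>finest_partition \<Gamma>. (card b)\<^sup>2)"

definition Phi :: "real \<Rightarrow> real mat \<Rightarrow> real mat \<Rightarrow> real" where
  "Phi \<kappa> S \<Gamma> = loss S \<Gamma> + \<kappa> * real (pen \<Gamma>)"

definition Psi :: "real \<Rightarrow> real mat \<Rightarrow> nat set set \<Rightarrow> real" where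
  "Psi \<kappa> S B = Phi \<kappa> S (block_restrict S B)"


section \<open>A real random access machine\<close>

text \<open>
  Programs are structured programs over arrays of exact reals and arrays of natural numbers
  (indices).  Every array is named and has cells \<open>(i, j)\<close> for all natural numbers \<open>i\<close>, \<open>j\<close>; a scalar
  is the cell \<open>(0, 0)\<close> of an array.  Each literal, memory access, arithmetic operation, comparison,
  square root, logarithm and Boolean connective costs one step, as does each assignment, skip and
  branching decision.

  Program literals are natural numbers, so a program cannot contain arbitrary reals.  There is no
  conversion between reals and indices (in particular no rounding), and index arithmetic consists of
  addition and truncated subtraction.
\<close>

type_synonym name = string

record store =
  imem :: "name \<Rightarrow> nat \<Rightarrow> nat \<Rightarrow> nat"
  rmem :: "name \<Rightarrow> nat \<Rightarrow> nat \<Rightarrow> real"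

datatype iexp =
    INum nat
  | IGet name iexp iexp
  | IAdd iexp iexp
  | ISub iexp iexp

datatype rexp =
    RNum nat
  | RGet name iexp iexp
  | RAdd rexp rexp
  | RSub rexp rexp
  | RMul rexp rexp
  | RDiv rexp rexp
  | RSqrt rexp
  | RLn rexp

datatype bexp =
    ILess iexp iexp
  | IEq iexp iexp
  | RLess rexp rexp
  | REq rexp rexp
  | BNot bexp
  | BAnd bexp bexp

datatype com =
    Skip
  | ISet name iexp iexp iexp
  | RSet name iexp iexp rexp
  | Seq com com
  | Cond bexp com com
  | While bexp com

primrec ival :: "iexp \<Rightarrow> store \<Rightarrow> nat" where
  "ival (INum k) \<sigma> = k"
| "ival (IGet x a b) \<sigma> = imem \<sigma> x (ival a \<sigma>) (ival b \<sigma>)"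
| "ival (IAdd a b) \<sigma> = ival a \<sigma> + ival b \<sigma>"
| "ival (ISub a b) \<sigma> = ival a \<sigma> - ival b \<sigma>"

primrec rval :: "rexp \<Rightarrow> store \<Rightarrow> real" where
  "rval (RNum k) \<sigma> = real k"
| "rval (RGet x a b) \<sigma> = rmem \<sigma> x (ival a \<sigma>) (ival b \<sigma>)"
| "rval (RAdd a b) \<sigma> = rval a \<sigma> + rval b \<sigma>"
| "rval (RSub a b) \<sigma> = rval a \<sigma> - rval b \<sigma>"
| "rval (RMul a b) \<sigma> = rval a \<sigma> * rval b \<sigma>"
| "rval (RDiv a b) \<sigma> = rval a \<sigma> / rval b \<sigma>"
| "rval (RSqrt a) \<sigma> = sqrt (rval a \<sigma>)"
| "rval (RLn a) \<sigma> = ln (rval a \<sigma>)"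

primrec bval :: "bexp \<Rightarrow> store \<Rightarrow> bool" where
  "bval (ILess a b) \<sigma> \<longleftrightarrow> ival a \<sigma> < ival b \<sigma>"
| "bval (IEq a b) \<sigma> \<longleftrightarrow> ival a \<sigma> = ival b \<sigma>"
| "bval (RLess a b) \<sigma> \<longleftrightarrow> rval a \<sigma> < rval b \<sigma>"
| "bval (REq a b) \<sigma> \<longleftrightarrow> rval a \<sigma> = rval b \<sigma>"
| "bval (BNot a) \<sigma> \<longleftrightarrow> \<not> bval a \<sigma>"
| "bval (BAnd a b) \<sigma> \<longleftrightarrow> bval a \<sigma> \<and> bval b \<sigma>"

text \<open>
  The HOL functions are total, but an evaluation that divides by zero, takes the square root of a
  negative number or the logarithm of a nonpositive number is regarded as undefined, and a
  program that attempts it gets stuck.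
\<close>

primrec rdefined :: "rexp \<Rightarrow> store \<Rightarrow> bool" where
  "rdefined (RNum k) \<sigma> \<longleftrightarrow> True"
| "rdefined (RGet x a b) \<sigma> \<longleftrightarrow> True"
| "rdefined (RAdd a b) \<sigma> \<longleftrightarrow> rdefined a \<sigma> \<and> rdefined b \<sigma>"
| "rdefined (RSub a b) \<sigma> \<longleftrightarrow> rdefined a \<sigma> \<and> rdefined b \<sigma>"
| "rdefined (RMul a b) \<sigma> \<longleftrightarrow> rdefined a \<sigma> \<and> rdefined b \<sigma>"
| "rdefined (RDiv a b) \<sigma> \<longleftrightarrow> rdefined a \<sigma> \<and> rdefined b \<sigma> \<and> rval b \<sigma> \<noteq> 0"
| "rdefined (RSqrt a) \<sigma> \<longleftrightarrow> rdefined a \<sigma> \<and> rval a \<sigma> \<ge> 0"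
| "rdefined (RLn a) \<sigma> \<longleftrightarrow> rdefined a \<sigma> \<and> rval a \<sigma> > 0"

primrec bdefined :: "bexp \<Rightarrow> store \<Rightarrow> bool" where
  "bdefined (ILess a b) \<sigma> \<longleftrightarrow> True"
| "bdefined (IEq a b) \<sigma> \<longleftrightarrow> True"
| "bdefined (RLess a b) \<sigma> \<longleftrightarrow> rdefined a \<sigma> \<and> rdefined b \<sigma>"
| "bdefined (REq a b) \<sigma> \<longleftrightarrow> rdefined a \<sigma> \<and> rdefined b \<sigma>"
| "bdefined (BNot a) \<sigma> \<longleftrightarrow> bdefined a \<sigma>"
| "bdefined (BAnd a b) \<sigma> \<longleftrightarrow> bdefined a \<sigma> \<and> bdefined b \<sigma>"

primrec icost :: "iexp \<Rightarrow> nat" where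
  "icost (INum k) = 1"
| "icost (IGet x a b) = icost a + icost b + 1"
| "icost (IAdd a b) = icost a + icost b + 1"
| "icost (ISub a b) = icost a + icost b + 1"

primrec rcost :: "rexp \<Rightarrow> nat" where
  "rcost (RNum k) = 1"
| "rcost (RGet x a b) = icost a + icost b + 1"
| "rcost (RAdd a b) = rcost a + rcost b + 1"
| "rcost (RSub a b) = rcost a + rcost b + 1"
| "rcost (RMul a b) = rcost a + rcost b + 1"
| "rcost (RDiv a b) = rcost a + rcost b + 1"
| "rcost (RSqrt a) = rcost a + 1"
| "rcost (RLn a) = rcost a + 1"

primrec bcost :: "bexp \<Rightarrow> nat" where
  "bcost (ILess a b) = icost a + icost b + 1"
| "bcost (IEq a b) = icost a + icost b + 1"
| "bcost (RLess a b) = rcost a + rcost b + 1"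
| "bcost (REq a b) = rcost a + rcost b + 1"
| "bcost (BNot a) = bcost a + 1"
| "bcost (BAnd a b) = bcost a + bcost b + 1"

definition iupdate :: "name \<Rightarrow> nat \<Rightarrow> nat \<Rightarrow> nat \<Rightarrow> store \<Rightarrow> store" where
  "iupdate x i j v \<sigma> = \<sigma>\<lparr>imem := (imem \<sigma>)(x := (imem \<sigma> x)(i := (imem \<sigma> x i)(j := v)))\<rparr>"

definition rupdate :: "name \<Rightarrow> nat \<Rightarrow> nat \<Rightarrow> real \<Rightarrow> store \<Rightarrow> store" where
  "rupdate x i j v \<sigma> = \<sigma>\<lparr>rmem := (rmem \<sigma>)(x := (rmem \<sigma> x)(i := (rmem \<sigma> x i)(j := v)))\<rparr>"

text \<open>\<open>exec c \<sigma> t \<tau>\<close>: started in \<open>\<sigma>\<close>, the program \<open>c\<close> halts in \<open>\<tau>\<close> after exactly \<open>t\<close> elementary operations.\<close>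

inductive exec :: "com \<Rightarrow> store \<Rightarrow> nat \<Rightarrow> store \<Rightarrow> bool" where
  exec_Skip: "exec Skip \<sigma> 1 \<sigma>"
| exec_ISet: "exec (ISet x a b e) \<sigma> (icost a + icost b + icost e + 1)
     (iupdate x (ival a \<sigma>) (ival b \<sigma>) (ival e \<sigma>) \<sigma>)"
| exec_RSet: "rdefined e \<sigma> \<Longrightarrow> exec (RSet x a b e) \<sigma> (icost a + icost b + rcost e + 1)
     (rupdate x (ival a \<sigma>) (ival b \<sigma>) (rval e \<sigma>) \<sigma>)"
| exec_Seq: "exec c \<sigma> t \<tau> \<Longrightarrow> exec d \<tau> u \<upsilon> \<Longrightarrow> exec (Seq c d) \<sigma> (t + u) \<upsilon>"
| exec_CondTrue: "bdefined b \<sigma> \<Longrightarrow> bval b \<sigma> \<Longrightarrow> exec c \<sigma> t \<tau> \<Longrightarrow> exec (Cond b c d) \<sigma> (bcost b + t + 1) \<tau>"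
| exec_CondFalse: "bdefined b \<sigma> \<Longrightarrow> \<not> bval b \<sigma> \<Longrightarrow> exec d \<sigma> t \<tau> \<Longrightarrow> exec (Cond b c d) \<sigma> (bcost b + t + 1) \<tau>"
| exec_WhileTrue: "bdefined b \<sigma> \<Longrightarrow> bval b \<sigma> \<Longrightarrow> exec c \<sigma> t \<tau> \<Longrightarrow> exec (While b c) \<tau> u \<upsilon> \<Longrightarrow>
     exec (While b c) \<sigma> (bcost b + t + u + 1) \<upsilon>"
| exec_WhileFalse: "bdefined b \<sigma> \<Longrightarrow> \<not> bval b \<sigma> \<Longrightarrow> exec (While b c) \<sigma> (bcost b + 1) \<sigma>"

lemma exec_deterministic:
  assumes "exec c \<sigma> t \<tau>" "exec c \<sigma> t' \<tau>'"
  shows "t' = t \<and> \<tau>' = \<tau>"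
  using assms
proof (induction arbitrary: t' \<tau>' rule: exec.induct)
  case (exec_Seq c \<sigma> t \<tau> d u \<upsilon>)
  from exec_Seq.prems show ?case by cases (use exec_Seq.IH in blast)
next
  case (exec_CondTrue b \<sigma> c t \<tau> d)
  from exec_CondTrue.prems show ?case by cases (use exec_CondTrue in blast)+
next
  case (exec_CondFalse b \<sigma> d t \<tau> c)
  from exec_CondFalse.prems show ?case by cases (use exec_CondFalse in blast)+
next
  case (exec_WhileTrue b \<sigma> c t \<tau> u \<upsilon>)
  from exec_WhileTrue.prems show ?case by cases (use exec_WhileTrue in blast)+
next
  case (exec_WhileFalse b \<sigma> c)
  from exec_WhileFalse.prems show ?case by cases (use exec_WhileFalse in blast)+
qed (auto elim: exec.cases)

text \<open>Only the input cells are prescribed; all other cells may initially hold arbitrary values.\<close>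

definition holds_input :: "store \<Rightarrow> nat \<Rightarrow> real mat \<Rightarrow> real \<Rightarrow> bool" where
  "holds_input \<sigma> p S \<kappa> \<longleftrightarrow>
     imem \<sigma> ''p'' 0 0 = p \<and> rmem \<sigma> ''kappa'' 0 0 = \<kappa> \<and>
     (\<forall>i<p. \<forall>j<p. rmem \<sigma> ''S'' i j = S $$ (i, j))"

text \<open>A partition is output as an array of block labels: \<open>i\<close> and \<open>j\<close> lie in the same block iff they
  carry the same label.\<close>

definition output_partition :: "store \<Rightarrow> nat \<Rightarrow> nat set set" where
  "output_partition \<sigma> p = (\<lambda>i. {j. j < p \<and> imem \<sigma> ''B'' j 0 = imem \<sigma> ''B'' i 0}) ` {..<p}"

end

theory Submission
  imports Defs
begin

text \<open>
  There are of the order of \<open>p\<^sup>2\<close> thresholds, and one value of the criterion costs a determinant, that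
  is, of the order of \<open>p\<^sup>3\<close> operations.  The bound \<open>O(p\<^sup>4)\<close> therefore rests on the fact that \<open>p\<close>
  thresholds, all computable in time \<open>O(p\<^sup>3)\<close>, already produce every threshold partition.

  To see this, let \<open>W i j\<close> be the absolute correlation of \<open>i\<close> and \<open>j\<close>, and let the bottleneck weight
  \<open>M i j\<close> be the largest \<open>u\<close> such that some path from \<open>i\<close> to \<open>j\<close> uses only edges of weight at least \<open>u\<close>.
  Two distinct indices lie in the same block of the partition at level \<open>u\<close> iff \<open>u < M i j\<close>, so the
  partition changes only when \<open>u\<close> passes a value of \<open>M\<close>.  Now \<open>M\<close> satisfies the ultrametric inequality
  \<open>min (M i k) (M k j) \<le> M i j\<close>, and an ultrametric on \<open>p\<close> points has at most \<open>p - 1\<close> values: adding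
  the points one at a time, the point \<open>c\<close> contributes only \<open>max\<^bsub>j < c\<^esub> M j c\<close>, because all its
  smaller weights have occurred before (\<open>ultrametric_values\<close>).  These column maxima, together with the least weight, which
  takes care of the thresholds below all values of \<open>M\<close>, are enough (\<open>column_max_levels\<close>,
  \<open>threshold_partitions\<close>).

  The criterion simplifies on such a partition (\<open>Psi_level_classes\<close>).  The inverse of a block matrix is a
  block matrix, so the trace term is the constant \<open>p\<close>; the blocks of the restricted matrix are exactly
  the classes, because they are connected by nonzero entries, so the penalty counts the pairs of
  equivalent indices; and the logarithm of the determinant is the sum of the logarithms of the pivots of
  Gaussian elimination, which on a positive definite matrix runs without row exchanges
  (\<open>ln_det_eq_sum_pivots\<close>).

  The program computes \<open>M\<close> by the max-min variant of the Floyd-Warshall recursion, evaluates the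
  simplified criterion at the \<open>p\<close> thresholds, remembers the best one and labels its classes.  All its
  loops run over \<open>0, \<dots>, p - 1\<close> and are nested at most four deep.  For such programs the running time can be
  bounded by recursion on the program text (\<open>bound\<close>), so that correctness and complexity are
  established by one set of rules in which time does not appear (\<open>runs\<close>, \<open>runs_For\<close>).
\<close>

section \<open>Programs with bounded loops\<close>

primrec iwrites :: "com \<Rightarrow> name set" where
  "iwrites Skip = {}"
| "iwrites (ISet x a b e) = {x}"
| "iwrites (RSet x a b e) = {}"
| "iwrites (Seq c d) = iwrites c \<union> iwrites d"
| "iwrites (Cond b c d) = iwrites c \<union> iwrites d"
| "iwrites (While b c) = iwrites c"

primrec rwrites :: "com \<Rightarrow> name set" where
  "rwrites Skip = {}"
| "rwrites (ISet x a b e) = {}"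
| "rwrites (RSet x a b e) = {x}"
| "rwrites (Seq c d) = rwrites c \<union> rwrites d"
| "rwrites (Cond b c d) = rwrites c \<union> rwrites d"
| "rwrites (While b c) = rwrites c"

text \<open>
  The running time if each execution of a loop makes at most \<open>n\<close> iterations.  For the two
  branches of a conditional the sum is taken instead of the maximum, which costs only a constant factor.
\<close>

primrec bound :: "nat \<Rightarrow> com \<Rightarrow> nat" where
  "bound n Skip = 1"
| "bound n (ISet x a b e) = icost a + icost b + icost e + 1"
| "bound n (RSet x a b e) = icost a + icost b + rcost e + 1"
| "bound n (Seq c d) = bound n c + bound n d"
| "bound n (Cond b c d) = bcost b + bound n c + bound n d + 1"
| "bound n (While b c) = n * (bcost b + bound n c + 1) + (bcost b + 1)"

primrec loop_depth :: "com \<Rightarrow> nat" where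
  "loop_depth Skip = 0"
| "loop_depth (ISet x a b e) = 0"
| "loop_depth (RSet x a b e) = 0"
| "loop_depth (Seq c d) = max (loop_depth c) (loop_depth d)"
| "loop_depth (Cond b c d) = max (loop_depth c) (loop_depth d)"
| "loop_depth (While b c) = Suc (loop_depth c)"

text \<open>
  Nesting one more loop multiplies the bound by \<open>n\<close>, up to constants, while all other constructs keep
  the degree.  The base is \<open>n + 1\<close> rather than \<open>n\<close> because a loop that makes no iteration still
  evaluates its test.
\<close>

lemma bound_le_power: "\<exists>K. \<forall>n. bound n c \<le> K * (n + 1) ^ loop_depth c"
proof (induction c)
  case (Seq c d)
  then obtain K L where KL: "\<And>n. bound n c \<le> K * (n + 1) ^ loop_depth c"
    "\<And>n. bound n d \<le> L * (n + 1) ^ loop_depth d" by blast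
  have "bound n (Seq c d) \<le> (K + L) * (n + 1) ^ loop_depth (Seq c d)" for n
  proof -
    have "(n + 1) ^ loop_depth c \<le> (n + 1) ^ loop_depth (Seq c d)"
      "(n + 1) ^ loop_depth d \<le> (n + 1) ^ loop_depth (Seq c d)"
      by (auto intro: power_increasing)
    then have "K * (n + 1) ^ loop_depth c \<le> K * (n + 1) ^ loop_depth (Seq c d)"
      "L * (n + 1) ^ loop_depth d \<le> L * (n + 1) ^ loop_depth (Seq c d)"
      by (auto intro: mult_le_mono2)
    with KL[of n] show ?thesis by (simp only: add_mult_distrib bound.simps)
  qed
  then show ?case by blast
next
  case (Cond b c d)
  then obtain K L where KL: "\<And>n. bound n c \<le> K * (n + 1) ^ loop_depth c"
    "\<And>n. bound n d \<le> L * (n + 1) ^ loop_depth d" by blast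
  have "bound n (Cond b c d) \<le> (bcost b + 1 + K + L) * (n + 1) ^ loop_depth (Cond b c d)" for n
  proof -
    have "(n + 1) ^ loop_depth c \<le> (n + 1) ^ loop_depth (Cond b c d)"
      "(n + 1) ^ loop_depth d \<le> (n + 1) ^ loop_depth (Cond b c d)"
      by (auto intro: power_increasing)
    then have "K * (n + 1) ^ loop_depth c \<le> K * (n + 1) ^ loop_depth (Cond b c d)"
      "L * (n + 1) ^ loop_depth d \<le> L * (n + 1) ^ loop_depth (Cond b c d)"
      by (auto intro: mult_le_mono2)
    moreover have "bcost b + 1 \<le> (bcost b + 1) * (n + 1) ^ loop_depth (Cond b c d)"
      using mult_le_mono2[of 1 "(n + 1) ^ loop_depth (Cond b c d)" "bcost b + 1"] by simp
    ultimately show ?thesis using KL[of n] by (simp only: add_mult_distrib bound.simps)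
  qed
  then show ?case by blast
next
  case (While b c)
  then obtain K where K: "\<And>n. bound n c \<le> K * (n + 1) ^ loop_depth c" by blast
  have "bound n (While b c) \<le> (bcost b + 1 + K) * (n + 1) ^ loop_depth (While b c)" for n
  proof -
    let ?q = "(n + 1) ^ loop_depth c"
    have "bcost b + 1 \<le> (bcost b + 1) * ?q"
      using mult_le_mono2[of 1 ?q "bcost b + 1"] by simp
    with K[of n] have "bcost b + bound n c + 1 \<le> (bcost b + 1 + K) * ?q"
      unfolding add_mult_distrib by linarith
    then have "n * (bcost b + bound n c + 1) \<le> n * ((bcost b + 1 + K) * ?q)"
      by (rule mult_le_mono2)
    moreover have "bcost b + 1 \<le> (bcost b + 1 + K) * ?q"
      using \<open>bcost b + 1 \<le> (bcost b + 1) * ?q\<close> unfolding add_mult_distrib by linarith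
    ultimately show ?thesis by (simp add: algebra_simps)
  qed
  then show ?case by blast
qed (auto intro: exI[of _ "_::nat"])

lemma bound_bigo: "(\<lambda>n. real (bound n c)) \<in> O(\<lambda>n. real n ^ loop_depth c)"
proof -
  obtain K where K: "\<And>n. bound n c \<le> K * (n + 1) ^ loop_depth c"
    using bound_le_power by blast
  have "real (bound n c) \<le> (real K * 2 ^ loop_depth c) * real n ^ loop_depth c" if "n \<ge> 1" for n
  proof -
    have "real (bound n c) \<le> real (K * (n + 1) ^ loop_depth c)"
      using K by (simp only: of_nat_le_iff)
    also have "\<dots> \<le> real K * (2 * real n) ^ loop_depth c"
      unfolding of_nat_mult of_nat_power
      by (intro mult_left_mono power_mono) (use that in auto)
    finally show ?thesis by (simp add: power_mult_distrib)
  qed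
  then show ?thesis
    by (intro bigoI[of _ "real K * 2 ^ loop_depth c"] eventually_sequentiallyI[of 1]) auto
qed

text \<open>
  The syntactic guarantee that a program leaves the arrays it never assigns to as they are.  Loop
  invariants then need to speak only about the arrays that the loop changes.
\<close>

definition frame :: "com \<Rightarrow> store \<Rightarrow> store \<Rightarrow> bool" where
  "frame c \<sigma> \<tau> \<longleftrightarrow> (\<forall>x. x \<notin> iwrites c \<longrightarrow> imem \<tau> x = imem \<sigma> x) \<and>
     (\<forall>x. x \<notin> rwrites c \<longrightarrow> rmem \<tau> x = rmem \<sigma> x)"

lemma frame_imem: "frame c \<sigma> \<tau> \<Longrightarrow> x \<notin> iwrites c \<Longrightarrow> imem \<tau> x = imem \<sigma> x"
  and frame_rmem: "frame c \<sigma> \<tau> \<Longrightarrow> x \<notin> rwrites c \<Longrightarrow> rmem \<tau> x = rmem \<sigma> x"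
  by (auto simp: frame_def)

lemma mem_update [simp]:
  "imem (iupdate x i j v \<sigma>) y = (if y = x then (imem \<sigma> x)(i := (imem \<sigma> x i)(j := v)) else imem \<sigma> y)"
  "rmem (iupdate x i j v \<sigma>) = rmem \<sigma>"
  "rmem (rupdate x i j w \<sigma>) y = (if y = x then (rmem \<sigma> x)(i := (rmem \<sigma> x i)(j := w)) else rmem \<sigma> y)"
  "imem (rupdate x i j w \<sigma>) = imem \<sigma>"
  by (auto simp: iupdate_def rupdate_def)

lemma exec_frame: "exec c \<sigma> t \<tau> \<Longrightarrow> frame c \<sigma> \<tau>"
  by (induction rule: exec.induct) (auto simp: frame_def)

text \<open>
  Total correctness from a fixed initial store, with the time limit tied to the program text so that
  the rules below compose without arithmetic on step counts.
\<close>

definition runs :: "nat \<Rightarrow> com \<Rightarrow> store \<Rightarrow> (store \<Rightarrow> bool) \<Rightarrow> bool" where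
  "runs n c \<sigma> Q \<longleftrightarrow> (\<exists>t \<tau>. exec c \<sigma> t \<tau> \<and> t \<le> bound n c \<and> Q \<tau>)"

lemma runs_mono:
  assumes "runs n c \<sigma> Q" "\<And>\<tau>. frame c \<sigma> \<tau> \<Longrightarrow> Q \<tau> \<Longrightarrow> R \<tau>"
  shows "runs n c \<sigma> R"
  using assms exec_frame unfolding runs_def by meson

lemma runs_Skip: "Q \<sigma> \<Longrightarrow> runs n Skip \<sigma> Q"
  unfolding runs_def using exec_Skip by fastforce

lemma runs_ISet: "Q (iupdate x (ival a \<sigma>) (ival b \<sigma>) (ival e \<sigma>) \<sigma>) \<Longrightarrow> runs n (ISet x a b e) \<sigma> Q"
  unfolding runs_def bound.simps using exec_ISet by blast

lemma runs_RSet: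
  "rdefined e \<sigma> \<Longrightarrow> Q (rupdate x (ival a \<sigma>) (ival b \<sigma>) (rval e \<sigma>) \<sigma>) \<Longrightarrow> runs n (RSet x a b e) \<sigma> Q"
  unfolding runs_def bound.simps using exec_RSet by blast

lemma runs_Seq: "runs n c \<sigma> (\<lambda>\<tau>. runs n d \<tau> Q) \<Longrightarrow> runs n (Seq c d) \<sigma> Q"
  unfolding runs_def bound.simps using exec_Seq add_le_mono by metis

lemma runs_Cond:
  assumes "bdefined b \<sigma>" "bval b \<sigma> \<Longrightarrow> runs n c \<sigma> Q" "\<not> bval b \<sigma> \<Longrightarrow> runs n d \<sigma> Q"
  shows "runs n (Cond b c d) \<sigma> Q"
proof (cases "bval b \<sigma>")
  case True
  with assms obtain t \<tau> where "exec c \<sigma> t \<tau>" "t \<le> bound n c" "Q \<tau>" by (auto simp: runs_def)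
  with exec_CondTrue[OF assms(1) True this(1)] show ?thesis
    unfolding runs_def by (intro exI[of _ "bcost b + t + 1"] exI[of _ \<tau>]) simp
next
  case False
  with assms obtain t \<tau> where "exec d \<sigma> t \<tau>" "t \<le> bound n d" "Q \<tau>" by (auto simp: runs_def)
  with exec_CondFalse[OF assms(1) False this(1)] show ?thesis
    unfolding runs_def by (intro exI[of _ "bcost b + t + 1"] exI[of _ \<tau>]) simp
qed

abbreviation ivar :: "name \<Rightarrow> iexp" where "ivar x \<equiv> IGet x (INum 0) (INum 0)"
abbreviation rvar :: "name \<Rightarrow> rexp" where "rvar x \<equiv> RGet x (INum 0) (INum 0)"
abbreviation iassign :: "name \<Rightarrow> iexp \<Rightarrow> com" where "iassign x \<equiv> ISet x (INum 0) (INum 0)"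
abbreviation rassign :: "name \<Rightarrow> rexp \<Rightarrow> com" where "rassign x \<equiv> RSet x (INum 0) (INum 0)"

text \<open>
  The loop limit is the input cell \<open>p\<close> of the machine.  The counter is left at the limit when the loop ends.
\<close>

definition For :: "name \<Rightarrow> com \<Rightarrow> com" where
  "For v c = Seq (iassign v (INum 0))
     (While (ILess (ivar v) (ivar ''p'')) (Seq c (iassign v (IAdd (ivar v) (INum 1)))))"

lemma writes_For [simp]:
  "iwrites (For v c) = insert v (iwrites c)" "rwrites (For v c) = rwrites c"
  "loop_depth (For v c) = Suc (loop_depth c)"
  by (auto simp: For_def)

text \<open>
  The invariant at \<open>k\<close> is meant for the store in which the counter has already been set to \<open>k\<close>.
\<close>

lemma runs_For:
  assumes p: "imem \<sigma> ''p'' 0 0 = n" and v: "v \<noteq> ''p''" "''p'' \<notin> iwrites c" "v \<notin> iwrites c"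
    and init: "I 0 (iupdate v 0 0 0 \<sigma>)"
    and step: "\<And>k \<tau>. k < n \<Longrightarrow> frame (For v c) \<sigma> \<tau> \<Longrightarrow> imem \<tau> v 0 0 = k \<Longrightarrow> I k \<tau> \<Longrightarrow>
      runs n c \<tau> (\<lambda>\<tau>'. I (Suc k) (iupdate v 0 0 (Suc k) \<tau>'))"
    and fin: "\<And>\<tau>. frame (For v c) \<sigma> \<tau> \<Longrightarrow> I n \<tau> \<Longrightarrow> Q \<tau>"
  shows "runs n (For v c) \<sigma> Q"
proof -
  let ?b = "ILess (ivar v) (ivar ''p'')" and ?d = "Seq c (iassign v (IAdd (ivar v) (INum 1)))"
  \<comment> \<open>\<open>m\<close> is the number of remaining iterations, in which the bound of the loop is linear.\<close>
  have loop: "\<exists>t \<tau>'. exec (While ?b ?d) \<tau> t \<tau>' \<and>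
      t \<le> m * (bcost ?b + bound n ?d + 1) + (bcost ?b + 1) \<and> Q \<tau>'"
    if "m \<le> n" "frame (For v c) \<sigma> \<tau>" "imem \<tau> v 0 0 = n - m" "I (n - m) \<tau>" for m \<tau>
    using that
  proof (induction m arbitrary: \<tau>)
    case 0
    then have "imem \<tau> ''p'' 0 0 = n" using v p by (auto simp: frame_imem)
    with 0 have "\<not> bval ?b \<tau>" by simp
    moreover have "Q \<tau>" using 0 fin by simp
    ultimately show ?case
      using exec_WhileFalse[of ?b \<tau> ?d] by (auto intro!: exI)
  next
    case (Suc m)
    let ?k = "n - Suc m"
    have k: "?k < n" "Suc ?k = n - m" using Suc.prems by auto
    have p\<tau>: "imem \<tau> ''p'' 0 0 = n" using v p Suc.prems by (auto simp: frame_imem)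
    obtain t \<tau>1 where e: "exec c \<tau> t \<tau>1" "t \<le> bound n c"
      and I: "I (Suc ?k) (iupdate v 0 0 (Suc ?k) \<tau>1)"
      using step[of ?k \<tau>] k Suc.prems unfolding runs_def by auto
    define \<tau>2 where "\<tau>2 = iupdate v 0 0 (Suc ?k) \<tau>1"
    have v1: "imem \<tau>1 v = imem \<tau> v" using exec_frame[OF e(1)] v by (auto simp: frame_imem)
    then have "ival (IAdd (ivar v) (INum 1)) \<tau>1 = Suc ?k" using Suc.prems by simp
    then have "exec ?d \<tau> (t + bound n (iassign v (IAdd (ivar v) (INum 1)))) \<tau>2"
      using exec_Seq[OF e(1) exec_ISet[of v "INum 0" "INum 0" "IAdd (ivar v) (INum 1)" \<tau>1]]
      by (simp add: \<tau>2_def)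
    then obtain t' where t': "exec ?d \<tau> t' \<tau>2" "t' \<le> bound n ?d"
      using e(2) by fastforce
    have "frame (For v c) \<tau> \<tau>2"
      using exec_frame[OF t'(1)] by (auto simp: frame_def)
    with Suc.prems have "frame (For v c) \<sigma> \<tau>2" by (simp add: frame_def)
    moreover have "imem \<tau>2 v 0 0 = n - m" "I (n - m) \<tau>2"
      using I k by (simp_all add: \<tau>2_def)
    ultimately obtain u \<tau>' where u: "exec (While ?b ?d) \<tau>2 u \<tau>'"
      "u \<le> m * (bcost ?b + bound n ?d + 1) + (bcost ?b + 1)" "Q \<tau>'"
      using Suc.IH[of \<tau>2] Suc.prems by auto
    have "exec (While ?b ?d) \<tau> (bcost ?b + t' + u + 1) \<tau>'"
      using t'(1) u(1) Suc.prems p\<tau> k by (intro exec_WhileTrue) auto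
    with t' u show ?case
      by (intro exI[of _ "bcost ?b + t' + u + 1"] exI[of _ \<tau>']) simp
  qed
  have "frame (For v c) \<sigma> (iupdate v 0 0 0 \<sigma>)" by (simp add: frame_def)
  with loop[of n "iupdate v 0 0 0 \<sigma>"] init
  have "runs n (While ?b ?d) (iupdate v 0 0 0 \<sigma>) Q"
    unfolding runs_def by simp
  then show ?thesis
    unfolding For_def by (intro runs_Seq runs_ISet) simp
qed

text \<open>
  Extrema are computed by arithmetic, \<open>\<bar>x\<bar>\<close> being the square root of \<open>x\<^sup>2\<close>, so that they can be used
  as expressions without branching.
\<close>

definition rabs :: "rexp \<Rightarrow> rexp" where "rabs a = RSqrt (RMul a a)"
definition rmax :: "rexp \<Rightarrow> rexp \<Rightarrow> rexp" where
  "rmax a b = RDiv (RAdd (RAdd a b) (rabs (RSub a b))) (RNum 2)"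
definition rmin :: "rexp \<Rightarrow> rexp \<Rightarrow> rexp" where
  "rmin a b = RDiv (RSub (RAdd a b) (rabs (RSub a b))) (RNum 2)"

lemma rval_minmax [simp]:
  "rval (rabs a) \<sigma> = \<bar>rval a \<sigma>\<bar>"
  "rval (rmax a b) \<sigma> = max (rval a \<sigma>) (rval b \<sigma>)"
  "rval (rmin a b) \<sigma> = min (rval a \<sigma>) (rval b \<sigma>)"
  by (auto simp: rabs_def rmax_def rmin_def)

lemma rdefined_minmax [simp]:
  "rdefined (rabs a) \<sigma> = rdefined a \<sigma>"
  "rdefined (rmax a b) \<sigma> = (rdefined a \<sigma> \<and> rdefined b \<sigma>)"
  "rdefined (rmin a b) \<sigma> = (rdefined a \<sigma> \<and> rdefined b \<sigma>)"
  by (auto simp: rabs_def rmax_def rmin_def)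

definition bor :: "bexp \<Rightarrow> bexp \<Rightarrow> bexp" where "bor a b = BNot (BAnd (BNot a) (BNot b))"

lemma bor [simp]: "bval (bor a b) \<sigma> \<longleftrightarrow> bval a \<sigma> \<or> bval b \<sigma>"
  "bdefined (bor a b) \<sigma> \<longleftrightarrow> bdefined a \<sigma> \<and> bdefined b \<sigma>"
  by (auto simp: bor_def)

section \<open>Bottleneck weights and their level classes\<close>

text \<open>
  One round of the Floyd-Warshall recursion over the semiring of maximum and minimum: \<open>k\<close> is admitted as
  an intermediate point of paths.
\<close>

definition maxmin_step :: "nat \<Rightarrow> (nat \<Rightarrow> nat \<Rightarrow> real) \<Rightarrow> nat \<Rightarrow> nat \<Rightarrow> real" where
  "maxmin_step k M i j = max (M i j) (min (M i k) (M k j))"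

primrec bottleneck :: "(nat \<Rightarrow> nat \<Rightarrow> real) \<Rightarrow> nat \<Rightarrow> nat \<Rightarrow> nat \<Rightarrow> real" where
  "bottleneck W 0 = W"
| "bottleneck W (Suc k) = maxmin_step k (bottleneck W k)"

lemma bottleneck_Suc:
  "bottleneck W (Suc k) i j = max (bottleneck W k i j) (min (bottleneck W k i k) (bottleneck W k k j))"
  by (simp add: maxmin_step_def)

text \<open>
  The round that admits \<open>k\<close> leaves row and column \<open>k\<close> unchanged; this is why the update can be done in place.
\<close>

lemma bottleneck_pivot:
  "bottleneck W (Suc k) i k = bottleneck W k i k"
  "bottleneck W (Suc k) k j = bottleneck W k k j"
  by (simp_all only: bottleneck_Suc max.absorb1 min.cobounded1 min.cobounded2)

lemma bottleneck_ge: "W i j \<le> bottleneck W k i j"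
  by (induction k) (auto simp: maxmin_step_def max.coboundedI1)

lemma bottleneck_sym:
  assumes "\<And>i j. i < p \<Longrightarrow> j < p \<Longrightarrow> W i j = W j i" "i < p" "j < p" "k \<le> p"
  shows "bottleneck W k i j = bottleneck W k j i"
  using assms(2-) by (induction k arbitrary: i j) (auto simp: maxmin_step_def assms(1) min.commute)

text \<open>
  The inequality behind \<open>bottleneck_trans\<close>, where \<open>a\<close>, \<open>b\<close>, \<open>c\<close>, \<open>d\<close>, \<open>e\<close>, \<open>f\<close>, \<open>x\<close> stand for the weights of
  \<open>(i, m)\<close>, \<open>(i, k)\<close>, \<open>(k, m)\<close>, \<open>(m, j)\<close>, \<open>(m, k)\<close>, \<open>(k, j)\<close>, \<open>(i, j)\<close> before the round \<open>k\<close>.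
\<close>

lemma min_max_through:
  fixes a b c d e f x :: real
  assumes "min a d \<le> x" "min a e \<le> b" "min c d \<le> f"
  shows "min (max a (min b c)) (max d (min e f)) \<le> max x (min b f)"
  using assms unfolding min_le_iff_disj le_max_iff_disj max.bounded_iff min.bounded_iff
  by linarith

text \<open>
  With \<open>k = p\<close> this is the ultrametric inequality on \<open>{..<p}\<close>.  It replaces the usual
  description of the recursion by optimal paths.
\<close>

lemma bottleneck_trans:
  "m < k \<Longrightarrow> min (bottleneck W k i m) (bottleneck W k m j) \<le> bottleneck W k i j"
proof (induction k arbitrary: i j)
  case (Suc k)
  show ?case
  proof (cases "m = k")
    case True
    then show ?thesis unfolding True bottleneck_pivot by (simp only: bottleneck_Suc max.cobounded2)
  next
    case False
    with Suc.prems have "m < k" by simp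
    note IH = Suc.IH[OF this]
    from IH[of i j] IH[of i k] IH[of k j] show ?thesis
      unfolding bottleneck_Suc by (rule min_max_through)
  qed
qed simp

text \<open>
  Keeps the level classes from being too coarse: a partition whose blocks are not left by any edge of
  weight above \<open>u\<close> cannot separate two indices whose bottleneck weight exceeds \<open>u\<close>.
\<close>

lemma bottleneck_reachable:
  assumes "u < bottleneck W k i j" "i < p" "j < p" "k \<le> p"
  shows "(i, j) \<in> {(a, b). a < p \<and> b < p \<and> u < W a b}\<^sup>*"
  using assms
proof (induction k arbitrary: i j)
  case (Suc k)
  from Suc.prems(1) consider "u < bottleneck W k i j" | "u < bottleneck W k i k" "u < bottleneck W k k j"
    by (auto simp: maxmin_step_def less_max_iff_disj)
  then show ?case
  proof cases
    case 2
    with Suc.IH[of i k] Suc.IH[of k j] Suc.prems show ?thesis by (auto intro: rtrancl_trans)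
  qed (use Suc in auto)
qed auto

text \<open>
  Off the diagonal, maxima and minima of weights are weights, so every bottleneck value is itself an
  admissible threshold.  A diagonal entry could enter only in a round that leaves \<open>(i, j)\<close> unchanged.
\<close>

lemma bottleneck_value:
  assumes "i \<noteq> j" "i < p" "j < p" "k \<le> p"
  shows "bottleneck W k i j \<in> {W a b | a b. a \<noteq> b \<and> a < p \<and> b < p}"
  using assms
proof (induction k arbitrary: i j)
  case (Suc k)
  consider "k = i" | "k = j" | "k \<noteq> i" "k \<noteq> j" by blast
  then show ?case
  proof cases
    case 3
    have "bottleneck W (Suc k) i j \<in> {bottleneck W k i j, bottleneck W k i k, bottleneck W k k j}"
      by (auto simp: maxmin_step_def max_def min_def)
    moreover have "\<dots> \<subseteq> {W a b | a b. a \<noteq> b \<and> a < p \<and> b < p}"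
      using 3 Suc.IH[of i j] Suc.IH[of i k] Suc.IH[of k j] Suc.prems by auto
    ultimately show ?thesis by (rule rev_subsetD)
  next
    case 1
    then have "bottleneck W (Suc k) i j = bottleneck W k i j" using bottleneck_pivot(2) by simp
    with Suc show ?thesis by simp
  next
    case 2
    then have "bottleneck W (Suc k) i j = bottleneck W k i j" using bottleneck_pivot(1) by simp
    with Suc show ?thesis by simp
  qed
qed auto

text \<open>
  The lower bound \<open>l\<close> makes column 0, which has no entries above the diagonal, contribute \<open>l\<close> itself.
\<close>

definition column_max :: "real \<Rightarrow> (nat \<Rightarrow> nat \<Rightarrow> real) \<Rightarrow> nat \<Rightarrow> real" where
  "column_max l M c = Max (insert l ((\<lambda>j. M j c) ` {..<c}))"

lemma column_max_0 [simp]: "column_max l M 0 = l"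
  by (simp add: column_max_def)

text \<open>
  Add the points one at a time.  If \<open>q < c\<close> attains the maximum \<open>u\<close> of column \<open>c\<close>, then
  \<open>M i c = min (M i q) u\<close> for every other \<open>i < c\<close>, so column \<open>c\<close> adds at most the value \<open>u\<close> to those
  found among the points before \<open>c\<close>.  If the maximum is the lower bound \<open>l\<close>, the whole column equals \<open>l\<close>.
\<close>

lemma ultrametric_values:
  assumes tri: "\<And>i j k. i < p \<Longrightarrow> j < p \<Longrightarrow> k < p \<Longrightarrow> min (M i k) (M k j) \<le> M i j"
    and sym: "\<And>i j. i < p \<Longrightarrow> j < p \<Longrightarrow> M i j = M j i"
    and low: "\<And>i j. i < j \<Longrightarrow> j < p \<Longrightarrow> l \<le> M i j"
    and ij: "i < j" "j < p"
  shows "M i j \<in> column_max l M ` {1..j}"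
  using ij
proof (induction j arbitrary: i rule: less_induct)
  case (less c)
  let ?u = "column_max l M c"
  have "?u \<in> insert l ((\<lambda>j. M j c) ` {..<c})"
    unfolding column_max_def by (rule Max_in) auto
  then consider "?u = l" | q where "q < c" "?u = M q c" by auto
  moreover have le: "M x c \<le> ?u" if "x < c" for x
    unfolding column_max_def using that by (intro Max_ge) auto
  moreover have c: "c \<in> {1..c}" using less.prems by auto
  ultimately show ?case
  proof cases
    case 1
    with le[OF less.prems(1)] low[OF less.prems] have "M i c = ?u" by simp
    with c show ?thesis by blast
  next
    case 2
    show ?thesis
    proof (cases "i = q")
      case True
      with 2 c show ?thesis by (metis imageI)
    next
      case False
      have "M i c = min (M i q) ?u"
        using tri[of i c q] tri[of i q c] sym[of c q] le[OF less.prems(1)] 2 less.prems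
        by (auto simp: min_def split: if_splits)
      moreover have "M i q \<in> column_max l M ` {1..c}"
      proof (cases "i < q")
        case True
        then have "M i q \<in> column_max l M ` {1..q}" using 2 less by auto
        then show ?thesis using 2 by auto
      next
        case no: False
        then have "M q i \<in> column_max l M ` {1..i}" using False less by auto
        then show ?thesis using less.prems 2 sym[of q i] by auto
      qed
      ultimately show ?thesis using c by (auto simp: min_def)
    qed
  qed
qed

text \<open>
  Lowering a level \<open>u\<close> to the largest value of \<open>M\<close> that is at most \<open>u\<close> does not change which weights exceed
  it, and that value is a column maximum.  If there is no such value, all weights exceed \<open>u\<close>, hence
  also \<open>l\<close>, which is the value of column 0.
\<close>

lemma column_max_levels:
  assumes tri: "\<And>i j k. i < p \<Longrightarrow> j < p \<Longrightarrow> k < p \<Longrightarrow> min (M i k) (M k j) \<le> M i j"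
    and sym: "\<And>i j. i < p \<Longrightarrow> j < p \<Longrightarrow> M i j = M j i"
    and low: "\<And>i j. i < j \<Longrightarrow> j < p \<Longrightarrow> l \<le> M i j"
    and u: "l \<le> u" and p: "0 < p"
  shows "\<exists>c<p. \<forall>i<p. \<forall>j<p. i \<noteq> j \<longrightarrow> (u < M i j \<longleftrightarrow> column_max l M c < M i j)"
proof -
  let ?V = "{M i j | i j. i < j \<and> j < p \<and> M i j \<le> u}"
  \<comment> \<open>By symmetry it suffices to compare the weights above the diagonal.\<close>
  have red: "\<exists>c<p. \<forall>i<p. \<forall>j<p. i \<noteq> j \<longrightarrow> (u < M i j \<longleftrightarrow> column_max l M c < M i j)"
    if "\<exists>c<p. \<forall>i j. i < j \<longrightarrow> j < p \<longrightarrow> (u < M i j \<longleftrightarrow> column_max l M c < M i j)"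
    using that sym by (metis linorder_neqE_nat)
  show ?thesis
  proof (cases "?V = {}")
    case True
    then have "u < M i j" if "i < j" "j < p" for i j using that by (auto simp: not_le[symmetric])
    then show ?thesis using p u by (intro red exI[of _ 0]) force
  next
    case False
    have "finite ?V"
      by (rule finite_subset[of _ "(\<lambda>(i, j). M i j) ` ({..<p} \<times> {..<p})"]) auto
    then have "Max ?V \<in> ?V" and ge: "\<And>x. x \<in> ?V \<Longrightarrow> x \<le> Max ?V"
      using False by (simp_all only: Max_in Max_ge not_False_eq_True)
    then obtain i j where ij: "Max ?V = M i j" "i < j" "j < p" "M i j \<le> u" by blast
    then obtain c where c: "M i j = column_max l M c" "c \<le> j"
      using ultrametric_values[of p M l i j] assms by auto
    have "u < M a b \<longleftrightarrow> column_max l M c < M a b" if "a < b" "b < p" for a b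
      using ge[of "M a b"] that ij c by force
    with c ij show ?thesis by (intro red) (auto intro: exI[of _ c])
  qed
qed

text \<open>
  Reflexivity is imposed by \<open>i = j\<close>, since the diagonal of \<open>M\<close> is arbitrary.
\<close>

definition level_classes :: "nat \<Rightarrow> (nat \<Rightarrow> nat \<Rightarrow> real) \<Rightarrow> real \<Rightarrow> nat set set" where
  "level_classes p M u = (\<lambda>i. {j. j < p \<and> (i = j \<or> u < M i j)}) ` {..<p}"

locale bottleneck_levels =
  fixes p :: nat and M :: "nat \<Rightarrow> nat \<Rightarrow> real"
  assumes M_sym: "i < p \<Longrightarrow> j < p \<Longrightarrow> M i j = M j i"
    and M_tri: "i < p \<Longrightarrow> j < p \<Longrightarrow> k < p \<Longrightarrow> min (M i k) (M k j) \<le> M i j"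
begin

lemma level_trans:
  assumes "i < p" "j < p" "k < p" "i = k \<or> u < M i k" "k = j \<or> u < M k j"
  shows "i = j \<or> u < M i j"
  using assms M_tri[of i j k] by (auto simp: min_def split: if_splits)

lemma same_level_class:
  assumes "i < p" "j < p"
  shows "(\<exists>b\<in>level_classes p M u. i \<in> b \<and> j \<in> b) \<longleftrightarrow> i = j \<or> u < M i j"
proof
  assume "\<exists>b\<in>level_classes p M u. i \<in> b \<and> j \<in> b"
  then obtain k where "k < p" "k = i \<or> u < M k i" "k = j \<or> u < M k j"
    by (auto simp: level_classes_def)
  then show "i = j \<or> u < M i j"
    using level_trans[of i j k u] assms M_sym[of i k] by auto
qed (use assms in \<open>auto simp: level_classes_def\<close>)

lemma partition_on_level_classes: "partition_on {..<p} (level_classes p M u)"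
proof (rule partition_onI)
  fix a b assume ab: "a \<in> level_classes p M u" "b \<in> level_classes p M u" "a \<noteq> b"
  then obtain i j where ij: "i < p" "j < p" "a = {k. k < p \<and> (i = k \<or> u < M i k)}"
    "b = {k. k < p \<and> (j = k \<or> u < M j k)}"
    by (auto simp: level_classes_def)
  show "disjnt a b"
  proof (rule ccontr)
    assume "\<not> disjnt a b"
    then obtain k where k: "k \<in> a" "k \<in> b" by (auto simp: disjnt_def)
    then have "i = j \<or> u < M i j" "j = i \<or> u < M j i"
      using ij level_trans[of i j k u] M_sym[of j k] M_sym[of i j] by auto
    then have "a = b"
      unfolding ij(3,4) using ij(1,2) level_trans[of i _ j u] level_trans[of j _ i u] by blast
    with ab show False by simp
  qed
qed (auto simp: level_classes_def)

text \<open>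
  The label of \<open>i\<close> lies in the class of \<open>i\<close>, so equal labels force equal classes.
\<close>

lemma label_level_classes:
  assumes L: "\<And>i. i < p \<Longrightarrow> L i = Max {j. j < p \<and> (i = j \<or> u < M i j)}"
  shows "(\<lambda>i. {j. j < p \<and> L j = L i}) ` {..<p} = level_classes p M u"
  unfolding level_classes_def
proof (intro image_cong refl)
  have in_class: "L i < p" "i = L i \<or> u < M i (L i)" if "i < p" for i
  proof -
    have "L i \<in> {j. j < p \<and> (i = j \<or> u < M i j)}"
      unfolding L[OF that] by (rule Max_in) (use that in auto)
    then show "L i < p" "i = L i \<or> u < M i (L i)" by auto
  qed
  fix i assume "i \<in> {..<p}"
  then have i: "i < p" by simp
  have "L j = L i \<longleftrightarrow> i = j \<or> u < M i j" if j: "j < p" for j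
  proof
    assume "L j = L i"
    then show "i = j \<or> u < M i j"
      using level_trans[of i j "L i" u] in_class[OF i] in_class[OF j] i j M_sym[of j "L i"] by auto
  next
    assume ij: "i = j \<or> u < M i j"
    then have "j = i \<or> u < M j i" using M_sym[of i j] i j by auto
    with ij have "{k. k < p \<and> (i = k \<or> u < M i k)} = {k. k < p \<and> (j = k \<or> u < M j k)}"
      using level_trans[of i _ j u] level_trans[of j _ i u] i j by blast
    then show "L j = L i" using L[OF i] L[OF j] by simp
  qed
  then show "{j. j < p \<and> L j = L i} = {j. j < p \<and> (i = j \<or> u < M i j)}" by auto
qed

text \<open>
  The penalty as a number of pairs, which a double loop can count without knowing the blocks.
\<close>

lemma card_level_classes:
  "(\<Sum>b\<in>level_classes p M u. (card b)\<^sup>2) = card {(i, j). i < p \<and> j < p \<and> (i = j \<or> u < M i j)}"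
proof -
  let ?P = "level_classes p M u"
  have P: "finite b" if "b \<in> ?P" for b
    using that by (auto simp: level_classes_def)
  have "{(i, j). i < p \<and> j < p \<and> (i = j \<or> u < M i j)} = (\<Union>b\<in>?P. b \<times> b)"
  proof -
    have "(i < p \<and> j < p \<and> (i = j \<or> u < M i j)) \<longleftrightarrow> (\<exists>b\<in>?P. i \<in> b \<and> j \<in> b)" for i j
      using same_level_class[of i j u] by (auto simp: level_classes_def)
    then show ?thesis by auto
  qed
  also have "card \<dots> = (\<Sum>b\<in>?P. card (b \<times> b))"
  proof (rule card_UN_disjoint)
    show "\<forall>i\<in>?P. \<forall>j\<in>?P. i \<noteq> j \<longrightarrow> i \<times> i \<inter> j \<times> j = {}"
      using partition_on_level_classes[of u] by (auto simp: partition_on_def disjoint_def)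
  qed (auto simp: P level_classes_def)
  finally show ?thesis by (simp add: card_cartesian_product power2_eq_square)
qed

end

section \<open>Elimination for positive definite block matrices\<close>

text \<open>
  Positive definiteness for entries given by a function, so that elimination can change the entries
  without any conversion to and from matrices.
\<close>

definition pos_def_on :: "nat \<Rightarrow> (nat \<Rightarrow> nat \<Rightarrow> real) \<Rightarrow> bool" where
  "pos_def_on n A \<longleftrightarrow> (\<forall>v. (\<exists>i<n. v i \<noteq> 0) \<longrightarrow> 0 < (\<Sum>i<n. \<Sum>j<n. v i * A i j * v j))"

lemma pos_def_onD:
  "pos_def_on n A \<Longrightarrow> i < n \<Longrightarrow> v i \<noteq> 0 \<Longrightarrow> 0 < (\<Sum>i<n. \<Sum>j<n. v i * A i j * v j)"
  by (auto simp: pos_def_on_def)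

lemma pos_def_on_cong:
  assumes "pos_def_on n A" "\<And>i j. i < n \<Longrightarrow> j < n \<Longrightarrow> A i j = B i j"
  shows "pos_def_on n B"
proof -
  have "(\<Sum>i<n. \<Sum>j<n. v i * A i j * v j) = (\<Sum>i<n. \<Sum>j<n. v i * B i j * v j)" for v
    using assms(2) by (intro sum.cong) auto
  with assms(1) show ?thesis by (simp add: pos_def_on_def)
qed

lemma pos_def_on_nonneg:
  assumes "pos_def_on n A" shows "0 \<le> (\<Sum>i<n. \<Sum>j<n. v i * A i j * v j)"
proof (cases "\<exists>i<n. v i \<noteq> 0")
  case True
  with assms show ?thesis by (auto simp: pos_def_on_def less_imp_le)
qed simp

lemma positive_definite_pos_def_on:
  assumes "positive_definite A" "A \<in> carrier_mat n n"
  shows "pos_def_on n (\<lambda>i j. A $$ (i, j))"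
  unfolding pos_def_on_def
proof (intro allI impI)
  fix v :: "nat \<Rightarrow> real" assume v: "\<exists>i<n. v i \<noteq> 0"
  have "vec n v \<noteq> 0\<^sub>v n"
    using v by (metis index_vec index_zero_vec(1))
  then have "0 < vec n v \<bullet> (A *\<^sub>v vec n v)"
    using assms by (auto simp: positive_definite_def)
  also have "\<dots> = (\<Sum>i<n. \<Sum>j<n. v i * A $$ (i, j) * v j)"
    using assms(2) by (auto simp: scalar_prod_def atLeast0LessThan sum_distrib_left mult.assoc intro!: sum.cong)
  finally show "0 < (\<Sum>i<n. \<Sum>j<n. v i * A $$ (i, j) * v j)" .
qed

lemma pos_def_on_diag:
  assumes "pos_def_on n A" "i < n"
  shows "0 < A i i"
proof -
  have "0 < (\<Sum>a<n. \<Sum>b<n. (if a = i then 1 else 0) * A a b * (if b = i then 1 else 0))"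
    using pos_def_onD[OF assms, of "\<lambda>a. if a = i then 1 else 0"] by (simp only: simp_thms if_True zero_neq_one[symmetric])
  also have "\<dots> = A i i"
    using assms(2) by (simp add: if_distrib[of "\<lambda>x. x * _"] if_distrib[of "\<lambda>x. _ * x"] cong: if_cong)
  finally show ?thesis .
qed

text \<open>
  The blocks are disjoint, so a pair of indices lies in at most one of them.
\<close>

lemma partition_on_sum_pairs:
  fixes n :: nat and x :: real
  assumes P: "partition_on {..<n} P"
  shows "(\<Sum>b\<in>P. if i \<in> b \<and> j \<in> b then x else 0) = (if \<exists>b\<in>P. i \<in> b \<and> j \<in> b then x else 0)"
proof (cases "\<exists>b\<in>P. i \<in> b \<and> j \<in> b")
  case True
  then obtain b0 where b0: "b0 \<in> P" "i \<in> b0" "j \<in> b0" by blast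
  have "finite P" by (rule finite_elements[OF finite_lessThan P])
  have "(\<Sum>b\<in>P. if i \<in> b \<and> j \<in> b then x else 0) = (\<Sum>b\<in>P. if b = b0 then x else 0)"
    using P b0 by (intro sum.cong refl) (auto simp: partition_on_def disjoint_def)
  then show ?thesis using True b0 \<open>finite P\<close> by simp
next
  case False
  then have "(\<Sum>b\<in>P. if i \<in> b \<and> j \<in> b then x else 0) = 0" by (intro sum.neutral) auto
  with False show ?thesis by (simp only: if_False)
qed

text \<open>
  The quadratic form of the block matrix at \<open>v\<close> is the sum over the blocks of the original form at the
  restrictions of \<open>v\<close> to the blocks.
\<close>

lemma pos_def_on_blocks:
  assumes A: "pos_def_on n A" and P: "partition_on {..<n} P"
  shows "pos_def_on n (\<lambda>i j. if \<exists>b\<in>P. i \<in> b \<and> j \<in> b then A i j else 0)"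
  unfolding pos_def_on_def
proof (intro allI impI)
  fix v :: "nat \<Rightarrow> real" assume v: "\<exists>i<n. v i \<noteq> 0"
  \<comment> \<open>\<open>w b\<close> is the restriction of \<open>v\<close> to the block \<open>b\<close>.\<close>
  define w where "w b i = (if i \<in> b then v i else 0)" for b i
  have fin: "finite P" by (rule finite_elements[OF finite_lessThan P])
  have "(\<Sum>i<n. \<Sum>j<n. v i * (if \<exists>b\<in>P. i \<in> b \<and> j \<in> b then A i j else 0) * v j) =
      (\<Sum>i<n. \<Sum>j<n. \<Sum>b\<in>P. w b i * A i j * w b j)"
  proof (intro sum.cong refl)
    fix i j
    have "(\<Sum>b\<in>P. w b i * A i j * w b j) = (\<Sum>b\<in>P. if i \<in> b \<and> j \<in> b then v i * A i j * v j else 0)"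
      by (intro sum.cong) (auto simp: w_def)
    then show "v i * (if \<exists>b\<in>P. i \<in> b \<and> j \<in> b then A i j else 0) * v j = (\<Sum>b\<in>P. w b i * A i j * w b j)"
      unfolding partition_on_sum_pairs[OF P]
      by (cases "\<exists>b\<in>P. i \<in> b \<and> j \<in> b") (simp_all only: if_True if_False mult_zero_right mult_zero_left)
  qed
  also have "\<dots> = (\<Sum>i<n. \<Sum>b\<in>P. \<Sum>j<n. w b i * A i j * w b j)"
    by (intro sum.cong refl sum.swap)
  also have "\<dots> = (\<Sum>b\<in>P. \<Sum>i<n. \<Sum>j<n. w b i * A i j * w b j)"
    by (rule sum.swap)
  finally have eq: "(\<Sum>i<n. \<Sum>j<n. v i * (if \<exists>b\<in>P. i \<in> b \<and> j \<in> b then A i j else 0) * v j) =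
    (\<Sum>b\<in>P. \<Sum>i<n. \<Sum>j<n. w b i * A i j * w b j)" .
  obtain i where i: "i < n" "v i \<noteq> 0" using v by blast
  then have "i \<in> \<Union>P" using P by (auto simp: partition_on_def)
  then obtain b where b: "b \<in> P" "i \<in> b" by blast
  then have "0 < (\<Sum>i<n. \<Sum>j<n. w b i * A i j * w b j)"
    using i by (intro pos_def_onD[OF A, of i]) (auto simp: w_def)
  then have "0 < (\<Sum>b\<in>P. \<Sum>i<n. \<Sum>j<n. w b i * A i j * w b j)"
    using b by (intro sum_pos2[OF fin, of b] pos_def_on_nonneg A)
  then show "0 < (\<Sum>i<n. \<Sum>j<n. v i * (if \<exists>b\<in>P. i \<in> b \<and> j \<in> b then A i j else 0) * v j)"
    unfolding eq .
qed

text \<open>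
  Clears column \<open>k\<close> below the diagonal by subtracting multiples of row \<open>k\<close>.
\<close>

definition elim_step :: "nat \<Rightarrow> (nat \<Rightarrow> nat \<Rightarrow> real) \<Rightarrow> nat \<Rightarrow> nat \<Rightarrow> real" where
  "elim_step k A i j = (if k < i then A i j - A i k / A k k * A k j else A i j)"

primrec elim :: "(nat \<Rightarrow> nat \<Rightarrow> real) \<Rightarrow> nat \<Rightarrow> nat \<Rightarrow> nat \<Rightarrow> real" where
  "elim A 0 = A"
| "elim A (Suc k) = elim_step k (elim A k)"

definition unit_lower :: "(nat \<Rightarrow> nat \<Rightarrow> real) \<Rightarrow> bool" where
  "unit_lower L \<longleftrightarrow> (\<forall>i. L i i = 1) \<and> (\<forall>i j. i < j \<longrightarrow> L i j = 0)"

text \<open>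
  If \<open>E = L A\<close> and row \<open>k\<close> of \<open>E\<close> vanishes before the diagonal, then the quadratic form of \<open>A\<close> at row \<open>k\<close> of
  the unit lower triangular \<open>L\<close> is just the pivot \<open>E k k\<close>.
\<close>

lemma pivot_pos:
  assumes A: "pos_def_on n A" and k: "k < n" and L: "unit_lower L"
    and E: "\<And>j. j < n \<Longrightarrow> E k j = (\<Sum>l<n. L k l * A l j)"
    and zero: "\<And>j. j < k \<Longrightarrow> E k j = 0"
  shows "0 < E k k"
proof -
  have "0 < (\<Sum>i<n. \<Sum>j<n. L k i * A i j * L k j)"
    using L by (intro pos_def_onD[OF A k]) (auto simp: unit_lower_def)
  also have "\<dots> = (\<Sum>j<n. \<Sum>i<n. L k i * A i j * L k j)" by (rule sum.swap)
  also have "\<dots> = (\<Sum>j<n. E k j * L k j)"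
    by (intro sum.cong) (auto simp: E sum_distrib_right)
  also have "\<dots> = (\<Sum>j<n. if j = k then E k k else 0)"
    using L zero by (intro sum.cong refl) (auto simp: unit_lower_def neq_iff)
  also have "\<dots> = E k k" using k by simp
  finally show ?thesis .
qed

text \<open>
  The invariant of elimination: the current matrix is \<open>L A\<close> with \<open>L\<close> unit lower triangular, and its
  first \<open>k\<close> columns are cleared.  The next pivot is then positive by \<open>pivot_pos\<close>, so no row exchange is needed.
\<close>

lemma elim_factor:
  assumes A: "pos_def_on n A" and "k \<le> n"
  shows "\<exists>L. unit_lower L \<and> (\<forall>i<n. \<forall>j<n. elim A k i j = (\<Sum>l<n. L i l * A l j)) \<and>
    (\<forall>i<n. \<forall>j<k. j < i \<longrightarrow> elim A k i j = 0)"
  using assms(2)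
proof (induction k)
  case 0
  show ?case
    by (intro exI[of _ "\<lambda>i j. if i = j then 1 else 0"])
      (simp add: unit_lower_def if_distrib[of "\<lambda>x. x * _"] cong: if_cong)
next
  case (Suc k)
  then obtain L where L: "unit_lower L"
    and E: "\<And>i j. i < n \<Longrightarrow> j < n \<Longrightarrow> elim A k i j = (\<Sum>l<n. L i l * A l j)"
    and zero: "\<And>i j. i < n \<Longrightarrow> j < k \<Longrightarrow> j < i \<Longrightarrow> elim A k i j = 0"
    by auto
  have k: "k < n" using Suc.prems by simp
  have "0 < elim A k k k"
  proof (rule pivot_pos[where E = "elim A k", OF A k L])
    show "elim A k k j = (\<Sum>l<n. L k l * A l j)" if "j < n" for j using E[OF k that] .
    show "elim A k k j = 0" if "j < k" for j using zero[OF k that that] .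
  qed
  then have piv: "elim A k k k \<noteq> 0" by simp
  define r where "r i = elim A k i k / elim A k k k" for i
  define L' where "L' i l = (if k < i then L i l - r i * L k l else L i l)" for i l
  have "unit_lower L'" using L by (auto simp: unit_lower_def L'_def)
  moreover have "elim A (Suc k) i j = (\<Sum>l<n. L' i l * A l j)" if "i < n" "j < n" for i j
    using that k
    by (simp add: elim_step_def E L'_def r_def left_diff_distrib sum_subtractf sum_distrib_left mult.assoc)
  moreover have "elim A (Suc k) i j = 0" if "i < n" "j < Suc k" "j < i" for i j
    using that piv zero[of i j] zero[of k j] k by (auto simp: elim_step_def less_Suc_eq)
  ultimately show ?case by blast
qed

lemma elim_pivot_pos:
  assumes A: "pos_def_on n A" and k: "k < n"
  shows "0 < elim A k k k"
proof -
  obtain L where L: "unit_lower L"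
    and E: "\<forall>i<n. \<forall>j<n. elim A k i j = (\<Sum>l<n. L i l * A l j)"
    and zero: "\<forall>i<n. \<forall>j<k. j < i \<longrightarrow> elim A k i j = 0"
    using elim_factor[OF A less_imp_le[OF k]] by blast
  show ?thesis
  proof (rule pivot_pos[where E = "elim A k", OF A k L])
    show "elim A k k j = (\<Sum>l<n. L k l * A l j)" if "j < n" for j
      using E k that by blast
    show "elim A k k j = 0" if "j < k" for j using zero k that by blast
  qed
qed

text \<open>
  Row \<open>i\<close> is final once it has become the pivot row.
\<close>

lemma elim_row_final:
  "i \<le> k \<Longrightarrow> elim A k i j = elim A i i j"
  by (induction k rule: dec_induct) (auto simp: elim_step_def)

lemma det_eq_prod_pivots:
  assumes A: "pos_def_on n A"
  shows "det (mat n n (\<lambda>(i, j). A i j)) = (\<Prod>k<n. elim A k k k)"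
proof -
  let ?m = "\<lambda>F. mat n n (\<lambda>(i, j). F i j) :: real mat"
  obtain L where L: "unit_lower L"
    and E: "\<forall>i<n. \<forall>j<n. elim A n i j = (\<Sum>l<n. L i l * A l j)"
    and zero: "\<forall>i<n. \<forall>j<n. j < i \<longrightarrow> elim A n i j = 0"
    using elim_factor[OF A order_refl] by blast
  have "det (?m L) = 1"
    using L by (subst det_lower_triangular[where n = n]) (auto simp: unit_lower_def prod_list_diag_prod)
  moreover have "?m (elim A n) = ?m L * ?m A"
    using E by (intro eq_matI) (auto simp: scalar_prod_def atLeast0LessThan)
  ultimately have "det (?m A) = det (?m (elim A n))"
    by (simp add: det_mult[of _ n])
  also have "\<dots> = (\<Prod>k<n. elim A n k k)"
    using zero by (subst det_upper_triangular[where n = n])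
      (auto simp: prod_list_diag_prod atLeast0LessThan)
  also have "\<dots> = (\<Prod>k<n. elim A k k k)"
    by (intro prod.cong refl elim_row_final) simp
  finally show ?thesis .
qed

lemma ln_det_eq_sum_pivots:
  assumes A: "pos_def_on n A"
  shows "ln (det (mat n n (\<lambda>(i, j). A i j))) = (\<Sum>k<n. ln (elim A k k k))"
  unfolding det_eq_prod_pivots[OF A]
  by (rule ln_prod) (auto dest: elim_pivot_pos[OF A] simp: less_imp_neq)

text \<open>
  The inverse \<open>B\<close> of a block matrix is again a block matrix: its restriction \<open>H\<close> to the blocks is also a
  left inverse.  Hence only the entries of \<open>S\<close> inside the blocks enter the trace of \<open>B * S\<close>, which is
  therefore the trace of the identity.
\<close>

lemma trace_inverse_block_restrict:
  assumes S: "S \<in> carrier_mat n n" and P: "partition_on {..<n} P"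
    and det: "det (block_restrict S P) \<noteq> 0"
  shows "trace (the (mat_inverse (block_restrict S P)) * S) = real n"
proof -
  let ?G = "block_restrict S P"
  let ?same = "\<lambda>i j. \<exists>b\<in>P. i \<in> b \<and> j \<in> b"
  have G: "?G \<in> carrier_mat n n" using S by (auto simp: block_restrict_def)
  have Gij: "?G $$ (i, j) = (if ?same i j then S $$ (i, j) else 0)" if "i < n" "j < n" for i j
    using that S by (auto simp: block_restrict_def)
  obtain B where B: "mat_inverse ?G = Some B"
    using mat_inverse(1)[OF G] det_non_zero_imp_unit[OF G det] by fastforce
  have inv: "?G * B = 1\<^sub>m n" "B * ?G = 1\<^sub>m n" and Bc: "B \<in> carrier_mat n n"
    using mat_inverse(2)[OF G B] by auto
  have same_refl: "?same i i" if "i < n" for i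
    using that P by (auto simp: partition_on_def)
  have same_trans: "?same i k" if "?same i j" "?same j k" for i j k
    using that P unfolding partition_on_def disjoint_def by blast
  \<comment> \<open>Both \<open>H\<close> and \<open>B\<close> turn out to be left inverses of the block matrix, so they coincide.\<close>
  define H where "H = mat n n (\<lambda>(i, j). if ?same i j then B $$ (i, j) else 0)"
  have Hc: "H \<in> carrier_mat n n" by (simp add: H_def)
  have BG: "(\<Sum>l<n. B $$ (i, l) * ?G $$ (l, j)) = (if i = j then 1 else 0)" if "i < n" "j < n" for i j
  proof -
    have "(B * ?G) $$ (i, j) = (if i = j then 1 else 0)" using that inv by simp
    then show ?thesis using that Bc G by (auto simp: scalar_prod_def atLeast0LessThan)
  qed
  have "H * ?G = 1\<^sub>m n"
  proof (intro eq_matI)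
    fix i j assume "i < dim_row (1\<^sub>m n :: real mat)" "j < dim_col (1\<^sub>m n :: real mat)"
    then have ij: "i < n" "j < n" by auto
    have "(H * ?G) $$ (i, j) = (\<Sum>l<n. H $$ (i, l) * ?G $$ (l, j))"
      using ij Hc G by (auto simp: scalar_prod_def atLeast0LessThan)
    also have "\<dots> = (\<Sum>l<n. if ?same i j then B $$ (i, l) * ?G $$ (l, j) else 0)"
    proof (intro sum.cong refl)
      fix l assume "l \<in> {..<n}"
      then have l: "l < n" by simp
      have "?same i l \<longleftrightarrow> ?same i j" if "?same l j"
        using that same_trans[of i l j] same_trans[of i j l] by blast
      then show "H $$ (i, l) * ?G $$ (l, j) = (if ?same i j then B $$ (i, l) * ?G $$ (l, j) else 0)"
        unfolding Gij[OF l ij(2)] H_def using ij l by auto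
    qed
    also have "\<dots> = (if i = j then 1 else 0)"
    proof (cases "?same i j")
      case True
      then show ?thesis using BG[OF ij] by (simp only: if_True)
    next
      case False
      with same_refl[OF ij(1)] have "i \<noteq> j" by blast
      with False show ?thesis by (simp only: if_False sum.neutral_const)
    qed
    finally show "(H * ?G) $$ (i, j) = 1\<^sub>m n $$ (i, j)" using ij by simp
  qed (use Hc G in auto)
  then have HB: "H = B"
    using inv(1) assoc_mult_mat[OF Hc G Bc] Hc Bc by simp
  have "trace (B * S) = (\<Sum>i<n. \<Sum>l<n. B $$ (i, l) * S $$ (l, i))"
    using Bc S by (auto simp: trace_def scalar_prod_def atLeast0LessThan intro!: sum.cong)
  also have "\<dots> = (\<Sum>i<n. \<Sum>l<n. B $$ (i, l) * ?G $$ (l, i))"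
  proof (intro sum.cong refl)
    fix i l assume "i \<in> {..<n}" "l \<in> {..<n}"
    then have il: "i < n" "l < n" by auto
    then have "B $$ (i, l) = 0" if "\<not> ?same i l"
      using arg_cong[OF HB, of "\<lambda>M. M $$ (i, l)"] that by (simp add: H_def)
    then show "B $$ (i, l) * S $$ (l, i) = B $$ (i, l) * ?G $$ (l, i)"
      unfolding Gij[OF il(2,1)] by auto
  qed
  also have "\<dots> = real n" using BG by simp
  finally show ?thesis using B by simp
qed

section \<open>Threshold partitions and their scores\<close>

lemma block_restrict_id_iff:
  assumes "\<Gamma> \<in> carrier_mat p p"
  shows "\<Gamma> = block_restrict \<Gamma> B \<longleftrightarrow>
    (\<forall>i<p. \<forall>j<p. \<Gamma> $$ (i, j) \<noteq> 0 \<longrightarrow> (\<exists>b\<in>B. i \<in> b \<and> j \<in> b))"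
proof
  assume eq: "\<Gamma> = block_restrict \<Gamma> B"
  show "\<forall>i<p. \<forall>j<p. \<Gamma> $$ (i, j) \<noteq> 0 \<longrightarrow> (\<exists>b\<in>B. i \<in> b \<and> j \<in> b)"
  proof (intro allI impI)
    fix i j assume ij: "i < p" "j < p" "\<Gamma> $$ (i, j) \<noteq> 0"
    then have "block_restrict \<Gamma> B $$ (i, j) \<noteq> 0" using eq by metis
    then show "\<exists>b\<in>B. i \<in> b \<and> j \<in> b"
      using ij assms by (auto simp: block_restrict_def split: if_splits)
  qed
next
  assume "\<forall>i<p. \<forall>j<p. \<Gamma> $$ (i, j) \<noteq> 0 \<longrightarrow> (\<exists>b\<in>B. i \<in> b \<and> j \<in> b)"
  with assms show "\<Gamma> = block_restrict \<Gamma> B"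
    unfolding block_restrict_def by (intro eq_matI) auto
qed

locale weights =
  fixes p :: nat and W :: "nat \<Rightarrow> nat \<Rightarrow> real"
  assumes W_sym: "i < p \<Longrightarrow> j < p \<Longrightarrow> W i j = W j i"
begin

abbreviation M :: "nat \<Rightarrow> nat \<Rightarrow> real" where "M \<equiv> bottleneck W p"

sublocale bottleneck_levels p M
proof unfold_locales
  show "M i j = M j i" if "i < p" "j < p" for i j
    using bottleneck_sym[OF W_sym that order_refl] .
  show "min (M i k) (M k j) \<le> M i j" if "k < p" for i j k
    using bottleneck_trans[OF that] .
qed

text \<open>
  The level classes contain all edges of \<open>\<Gamma>\<close>, and each class is connected already by edges of weight above
  \<open>u\<close>, all of which are edges of \<open>\<Gamma>\<close>.  The lemma is needed for two matrices: the thresholded correlation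
  matrix, and the covariance matrix restricted to the blocks, which may have many more nonzero entries.
\<close>

lemma finest_partition_level_classes:
  assumes \<Gamma>: "\<Gamma> \<in> carrier_mat p p"
    and lower: "\<And>i j. i < p \<Longrightarrow> j < p \<Longrightarrow> u < W i j \<Longrightarrow> \<Gamma> $$ (i, j) \<noteq> 0"
    and upper: "\<And>i j. i < p \<Longrightarrow> j < p \<Longrightarrow> \<Gamma> $$ (i, j) \<noteq> 0 \<Longrightarrow> i = j \<or> u < M i j"
  shows "finest_partition \<Gamma> = level_classes p M u"
proof -
  have "is_finest_partition \<Gamma> (level_classes p M u)"
    unfolding is_finest_partition_def
  proof (intro conjI allI impI)
    show "partition_on {..<dim_row \<Gamma>} (level_classes p M u)"
      using \<Gamma> partition_on_level_classes by simp
    show "\<Gamma> = block_restrict \<Gamma> (level_classes p M u)"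
      unfolding block_restrict_id_iff[OF \<Gamma>] using upper by (simp add: same_level_class)
    fix B assume B: "partition_on {..<dim_row \<Gamma>} B \<and> \<Gamma> = block_restrict \<Gamma> B"
    then have part: "partition_on {..<p} B"
      and edge: "\<And>i j. i < p \<Longrightarrow> j < p \<Longrightarrow> \<Gamma> $$ (i, j) \<noteq> 0 \<Longrightarrow> \<exists>b\<in>B. i \<in> b \<and> j \<in> b"
      using \<Gamma> by (auto simp: block_restrict_id_iff[OF \<Gamma>])
    have reach: "j \<in> b" if "(i, j) \<in> {(a, b). a < p \<and> b < p \<and> u < W a b}\<^sup>*" "i \<in> b" "b \<in> B" for i j b
      using that(1)
    proof (induction rule: rtrancl_induct)
      case (step k l)
      then obtain b' where b': "b' \<in> B" "k \<in> b'" "l \<in> b'" using lower edge by blast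
      then have "b' = b" using that(3) step.IH part by (auto simp: partition_on_def disjoint_def)
      with b' show ?case by simp
    qed (use that in simp)
    have "\<exists>b'\<in>B. b \<subseteq> b'" if bP: "b \<in> level_classes p M u" for b
    proof -
      obtain i where i: "i < p" "b = {j. j < p \<and> (i = j \<or> u < M i j)}"
        using bP by (auto simp: level_classes_def)
      then have "i \<in> \<Union>B" using part by (auto simp: partition_on_def)
      then obtain b' where b': "b' \<in> B" "i \<in> b'" by blast
      have "j \<in> b'" if "j \<in> b" for j
        using that i b' reach[of i j b'] bottleneck_reachable[of u W p i j p] by auto
      with b' show ?thesis by blast
    qed
    then show "refines {..<dim_row \<Gamma>} (level_classes p M u) B"
      using \<Gamma> part partition_on_level_classes by (simp add: refines_def)
  qed
  then show ?thesis
    unfolding finest_partition_def by (rule the1_equality[OF ex1_finest_partition[OF \<Gamma>]])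
qed

lemma threshold_partition_level_classes:
  assumes "C \<in> carrier_mat p p" "\<And>i j. i < p \<Longrightarrow> j < p \<Longrightarrow> \<bar>C $$ (i, j)\<bar> = W i j" "0 \<le> u"
  shows "threshold_partition C u = level_classes p M u"
  unfolding threshold_partition_def
proof (rule finest_partition_level_classes)
  let ?\<Gamma> = "mat (dim_row C) (dim_col C) (\<lambda>(i, j). if \<bar>C $$ (i, j)\<bar> > u then C $$ (i, j) else 0)"
  show "?\<Gamma> \<in> carrier_mat p p" using assms(1) by auto
  fix i j assume ij: "i < p" "j < p"
  show "?\<Gamma> $$ (i, j) \<noteq> 0" if "u < W i j"
    using that ij assms(1,3) assms(2)[OF ij] by auto
  show "i = j \<or> u < M i j" if "?\<Gamma> $$ (i, j) \<noteq> 0"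
    using that ij assms(1) assms(2)[OF ij] bottleneck_ge[of W i j p] by (auto split: if_splits)
qed

end

text \<open>
  The assumption \<open>p \<ge> 2\<close> makes sure that there is a threshold at all.
\<close>

locale covariance =
  fixes p :: nat and S :: "real mat"
  assumes S: "S \<in> carrier_mat p p" and pd: "positive_definite S" and p: "p \<ge> 2"
begin

lemma S_sym: "i < p \<Longrightarrow> j < p \<Longrightarrow> S $$ (i, j) = S $$ (j, i)"
  using pd S unfolding positive_definite_def by (metis carrier_matD index_transpose_mat(1))

lemma S_pos: "pos_def_on p (\<lambda>i j. S $$ (i, j))"
  by (rule positive_definite_pos_def_on[OF pd S])

lemma S_diag: "i < p \<Longrightarrow> 0 < S $$ (i, i)"
  using pos_def_on_diag[OF S_pos] by simp

definition W :: "nat \<Rightarrow> nat \<Rightarrow> real" where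
  "W i j = \<bar>S $$ (i, j)\<bar> / sqrt (S $$ (i, i) * S $$ (j, j))"

sublocale weights p W
  by unfold_locales (simp add: W_def S_sym mult.commute)

lemma correlation_W: "i < p \<Longrightarrow> j < p \<Longrightarrow> \<bar>correlation S $$ (i, j)\<bar> = W i j"
  using S S_diag[of i] S_diag[of j] by (simp add: correlation_def W_def abs_divide)

lemma W_nonneg: "i < p \<Longrightarrow> j < p \<Longrightarrow> 0 \<le> W i j"
  using correlation_W[of i j] by (metis abs_ge_zero)

lemma correlation_carrier: "correlation S \<in> carrier_mat p p"
  using S by (simp add: correlation_def)

lemma thresholds_W: "thresholds (correlation S) = {W i j | i j. i < j \<and> j < p}"
proof -
  have "dim_row (correlation S) = p" using S by (simp add: correlation_def)
  then have "(x = \<bar>correlation S $$ (i, j)\<bar> \<and> i < j \<and> j < dim_row (correlation S)) \<longleftrightarrow>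
      (x = W i j \<and> i < j \<and> j < p)" for x i j
    using correlation_W[of i j] by auto
  then show ?thesis unfolding thresholds_def by simp
qed

definition wmin :: real where "wmin = Min {W i j | i j. i < j \<and> j < p}"

lemma finite_values: "finite {W i j | i j. i < j \<and> j < p}"
  by (rule finite_subset[of _ "(\<lambda>(i, j). W i j) ` ({..<p} \<times> {..<p})"]) auto

lemma wmin_le: "i < j \<Longrightarrow> j < p \<Longrightarrow> wmin \<le> W i j"
  unfolding wmin_def using finite_values by (intro Min_le) auto

lemma wmin_in: "wmin \<in> {W i j | i j. i < j \<and> j < p}"
  unfolding wmin_def
proof (rule Min_in[OF finite_values])
  have "W 0 1 \<in> {W i j | i j. i < j \<and> j < p}" using p by fastforce
  then show "{W i j | i j. i < j \<and> j < p} \<noteq> {}" by blast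
qed

lemma wminI: "x \<in> {W i j | i j. i < j \<and> j < p} \<Longrightarrow> (\<And>i j. i < j \<Longrightarrow> j < p \<Longrightarrow> x \<le> W i j) \<Longrightarrow> x = wmin"
  unfolding wmin_def by (rule Min_eqI[symmetric, OF finite_values]) auto

text \<open>
  The \<open>p\<close> levels at which the criterion is evaluated.
\<close>

abbreviation threshold :: "nat \<Rightarrow> real" where "threshold \<equiv> column_max wmin M"

lemma threshold_in: 
  assumes "c < p" shows "threshold c \<in> {W i j | i j. i < j \<and> j < p}"
proof -
  have "threshold c \<in> insert wmin ((\<lambda>j. M j c) ` {..<c})"
    unfolding column_max_def by (rule Max_in) auto
  moreover have "M j c \<in> {W i j | i j. i < j \<and> j < p}" if "j < c" for j
  proof -
    have "M j c \<in> {W a b | a b. a \<noteq> b \<and> a < p \<and> b < p}"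
      using that assms by (intro bottleneck_value) auto
    then obtain a b where "M j c = W a b" "a \<noteq> b" "a < p" "b < p" by blast
    then have "M j c = W (min a b) (max a b)" "min a b < max a b" "max a b < p"
      using W_sym[of a b] by (simp_all add: min_def max_def)
    then show ?thesis by blast
  qed
  ultimately show ?thesis using wmin_in by (elim insertE imageE) (simp_all only: lessThan_iff)
qed

text \<open>
  Each column maximum is the absolute correlation of some pair, so it is a threshold; conversely, by
  \<open>column_max_levels\<close>, every threshold has the same level classes as one of them.
\<close>

lemma threshold_partitions:
  "threshold_partition (correlation S) ` thresholds (correlation S) =
    (\<lambda>c. level_classes p M (threshold c)) ` {..<p}"
proof -
  have tp: "threshold_partition (correlation S) u = level_classes p M u"
    if "u \<in> {W i j | i j. i < j \<and> j < p}" for u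
    using that W_nonneg
    by (intro threshold_partition_level_classes[OF correlation_carrier] correlation_W) auto
  have "\<exists>c<p. level_classes p M u = level_classes p M (threshold c)"
    if "u \<in> {W i j | i j. i < j \<and> j < p}" for u
  proof -
    have "\<exists>c<p. \<forall>i<p. \<forall>j<p. i \<noteq> j \<longrightarrow> (u < M i j \<longleftrightarrow> threshold c < M i j)"
    proof (rule column_max_levels)
      show "wmin \<le> M i j" if "i < j" "j < p" for i j
        using wmin_le[OF that] bottleneck_ge[of W i j p] by linarith
      show "wmin \<le> u" using that wmin_le by auto
      show "0 < p" using p by simp
    qed (fact M_tri M_sym)+
    then obtain c where c: "c < p" and
      eq: "\<And>i j. i < p \<Longrightarrow> j < p \<Longrightarrow> i \<noteq> j \<Longrightarrow> u < M i j \<longleftrightarrow> threshold c < M i j" by blast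
    have "level_classes p M u = level_classes p M (threshold c)"
      unfolding level_classes_def
    proof (intro image_cong refl Collect_cong)
      fix i j assume "i \<in> {..<p}"
      then show "(j < p \<and> (i = j \<or> u < M i j)) \<longleftrightarrow> (j < p \<and> (i = j \<or> threshold c < M i j))"
        using eq[of i j] by auto
    qed
    with c show ?thesis by blast
  qed
  note cover = this
  show ?thesis
    unfolding thresholds_W
  proof (intro equalityI subsetI; elim imageE)
    fix P u assume P: "P = threshold_partition (correlation S) u" and u: "u \<in> {W i j | i j. i < j \<and> j < p}"
    obtain c where "c < p" "level_classes p M u = level_classes p M (threshold c)"
      using cover[OF u] by blast
    then show "P \<in> (\<lambda>c. level_classes p M (threshold c)) ` {..<p}"
      unfolding P tp[OF u] by simp
  next
    fix P c assume P: "P = level_classes p M (threshold c)" and c: "c \<in> {..<p}"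
    then have "threshold c \<in> {W i j | i j. i < j \<and> j < p}" using threshold_in by simp
    then show "P \<in> threshold_partition (correlation S) ` {W i j | i j. i < j \<and> j < p}"
      unfolding P tp[OF \<open>threshold c \<in> _\<close>, symmetric] by (rule imageI)
  qed
qed

definition blocks :: "real \<Rightarrow> nat \<Rightarrow> nat \<Rightarrow> real" where
  "blocks u i j = (if i = j \<or> u < M i j then S $$ (i, j) else 0)"

text \<open>
  The criterion on level classes up to a positive affine transformation, in a form that needs no inverse
  matrix and no list of blocks.
\<close>

definition score :: "real \<Rightarrow> real \<Rightarrow> real" where
  "score \<kappa> u = (\<Sum>k<p. ln (elim (blocks u) k k k)) +
     real p * \<kappa> * real (card {(i, j). i < p \<and> j < p \<and> (i = j \<or> u < M i j)})"

lemma blocks_pos: "pos_def_on p (blocks u)"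
proof -
  have "pos_def_on p (\<lambda>i j. if \<exists>b\<in>level_classes p M u. i \<in> b \<and> j \<in> b then S $$ (i, j) else 0)"
    by (rule pos_def_on_blocks[OF S_pos partition_on_level_classes])
  then show ?thesis
    by (rule pos_def_on_cong) (simp add: same_level_class blocks_def)
qed

text \<open>
  A pair of weight above \<open>u \<ge> 0\<close> has a nonzero covariance.  Hence restricting the covariance matrix to the
  classes does not disconnect any of them, and the penalty sees exactly these classes.
\<close>

lemma Psi_level_classes:
  assumes "0 \<le> u"
  shows "Psi \<kappa> S (level_classes p M u) = score \<kappa> u / real p + 1"
proof -
  let ?P = "level_classes p M u"
  let ?G = "block_restrict S ?P"
  have G: "?G = mat p p (\<lambda>(i, j). blocks u i j)"
    using S same_level_class by (intro eq_matI) (auto simp: block_restrict_def blocks_def)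
  then have Gc: "?G \<in> carrier_mat p p" by simp
  have ln_det: "ln (det ?G) = (\<Sum>k<p. ln (elim (blocks u) k k k))"
    unfolding G by (rule ln_det_eq_sum_pivots[OF blocks_pos])
  have "det ?G > 0"
    unfolding G det_eq_prod_pivots[OF blocks_pos]
    by (rule prod_pos) (auto intro: elim_pivot_pos[OF blocks_pos])
  then have tr: "trace (the (mat_inverse ?G) * S) = real p"
    by (intro trace_inverse_block_restrict[OF S partition_on_level_classes]) simp
  have "finest_partition ?G = ?P"
  proof (rule finest_partition_level_classes[OF Gc])
    fix i j assume ij: "i < p" "j < p"
    show "?G $$ (i, j) \<noteq> 0" if "u < W i j"
    proof -
      have "S $$ (i, j) \<noteq> 0" using that assms by (auto simp: W_def)
      moreover have "u < M i j" using that bottleneck_ge[of W i j p] by linarith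
      ultimately show ?thesis using ij by (simp add: G blocks_def)
    qed
    show "i = j \<or> u < M i j" if "?G $$ (i, j) \<noteq> 0"
      using that ij by (auto simp: G blocks_def split: if_splits)
  qed
  then have "pen ?G = card {(i, j). i < p \<and> j < p \<and> (i = j \<or> u < M i j)}"
    by (simp add: pen_def card_level_classes)
  then show ?thesis
    using Gc p by (simp add: Psi_def Phi_def loss_def ln_det tr score_def field_simps)
qed

lemma is_arg_min_level_classes:
  assumes c: "c < p" and best: "\<And>d. d < p \<Longrightarrow> score \<kappa> (threshold c) \<le> score \<kappa> (threshold d)"
  shows "is_arg_min (Psi \<kappa> S)
    (\<lambda>B. B \<in> threshold_partition (correlation S) ` thresholds (correlation S))
    (level_classes p M (threshold c))"
proof -
  have "0 \<le> threshold d" if "d < p" for d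
    using threshold_in[OF that] W_nonneg by auto
  then have "Psi \<kappa> S (level_classes p M (threshold d)) = score \<kappa> (threshold d) / real p + 1" if "d < p" for d
    using that by (simp add: Psi_level_classes)
  with c best show ?thesis
    unfolding threshold_partitions is_arg_min_def by (auto simp: not_less divide_right_mono)
qed

end

section \<open>Programs for weights, bottlenecks and pivots\<close>

lemma frame_trans:
  assumes "frame c \<sigma> \<tau>" "frame d \<tau> \<upsilon>" "iwrites d \<subseteq> iwrites c" "rwrites d \<subseteq> rwrites c"
  shows "frame c \<sigma> \<upsilon>"
  using assms unfolding frame_def by (metis subsetD)

text \<open>
  A double loop whose body treats the index pairs independently of their order; the invariant is
  indexed by the set \<open>R\<close> of pairs already treated.
\<close>

lemma runs_For_pairs:
  assumes p: "imem \<sigma> ''p'' 0 0 = n" and v: "v \<noteq> ''p''" "w \<noteq> ''p''" "v \<noteq> w"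
    "''p'' \<notin> iwrites c" "v \<notin> iwrites c" "w \<notin> iwrites c"
    and counter: "\<And>R x k \<tau>. x = v \<or> x = w \<Longrightarrow> I R (iupdate x 0 0 k \<tau>) = I R \<tau>"
    and init: "I {} \<sigma>"
    and step: "\<And>R i j \<tau>. i < n \<Longrightarrow> j < n \<Longrightarrow> (i, j) \<notin> R \<Longrightarrow> frame (For v (For w c)) \<sigma> \<tau> \<Longrightarrow>
      imem \<tau> v 0 0 = i \<Longrightarrow> imem \<tau> w 0 0 = j \<Longrightarrow> I R \<tau> \<Longrightarrow> runs n c \<tau> (I (insert (i, j) R))"
    and fin: "\<And>\<tau>. frame (For v (For w c)) \<sigma> \<tau> \<Longrightarrow> I ({..<n} \<times> {..<n}) \<tau> \<Longrightarrow> Q \<tau>"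
  shows "runs n (For v (For w c)) \<sigma> Q"
proof (rule runs_For[where I = "\<lambda>i. I ({..<i} \<times> {..<n})", OF p v(1)])
  fix i \<tau>
  assume i: "i < n" and fr: "frame (For v (For w c)) \<sigma> \<tau>" and vi: "imem \<tau> v 0 0 = i"
    and I: "I ({..<i} \<times> {..<n}) \<tau>"
  show "runs n (For w c) \<tau> (\<lambda>\<tau>'. I ({..<Suc i} \<times> {..<n}) (iupdate v 0 0 (Suc i) \<tau>'))"
  proof (rule runs_For[where I = "\<lambda>j. I ({..<i} \<times> {..<n} \<union> {i} \<times> {..<j})"])
    show "imem \<tau> ''p'' 0 0 = n" using fr p v by (simp add: frame_imem)
    show "I ({..<i} \<times> {..<n} \<union> {i} \<times> {..<0}) (iupdate w 0 0 0 \<tau>)" using I by (simp add: counter)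
  next
    fix j \<tau>1
    assume j: "j < n" and fr1: "frame (For w c) \<tau> \<tau>1" and wj: "imem \<tau>1 w 0 0 = j"
      and I1: "I ({..<i} \<times> {..<n} \<union> {i} \<times> {..<j}) \<tau>1"
    have fr': "frame (For v (For w c)) \<sigma> \<tau>1" by (rule frame_trans[OF fr fr1]) auto
    have "imem \<tau>1 v 0 0 = i" using fr1 vi v by (simp add: frame_imem)
    then have "runs n c \<tau>1 (I (insert (i, j) ({..<i} \<times> {..<n} \<union> {i} \<times> {..<j})))"
      using i j fr' wj I1 by (intro step) auto
    moreover have "insert (i, j) ({..<i} \<times> {..<n} \<union> {i} \<times> {..<j}) = {..<i} \<times> {..<n} \<union> {i} \<times> {..<Suc j}"
      by auto
    ultimately show "runs n c \<tau>1 (\<lambda>\<tau>'. I ({..<i} \<times> {..<n} \<union> {i} \<times> {..<Suc j}) (iupdate w 0 0 (Suc j) \<tau>'))"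
      by (simp add: counter)
  next
    fix \<tau>1 assume "I ({..<i} \<times> {..<n} \<union> {i} \<times> {..<n}) \<tau>1"
    moreover have "{..<i} \<times> {..<n} \<union> {i} \<times> {..<n} = {..<Suc i} \<times> {..<n}" by auto
    ultimately show "I ({..<Suc i} \<times> {..<n}) (iupdate v 0 0 (Suc i) \<tau>1)" by (simp add: counter)
  qed (use v in auto)
qed (use v counter init fin in auto)

abbreviation rcell :: "name \<Rightarrow> name \<Rightarrow> name \<Rightarrow> rexp" where
  "rcell x i j \<equiv> RGet x (ivar i) (ivar j)"
abbreviation rcell_assign :: "name \<Rightarrow> name \<Rightarrow> name \<Rightarrow> rexp \<Rightarrow> com" where
  "rcell_assign x i j \<equiv> RSet x (ivar i) (ivar j)"

definition weights_com :: com where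
  "weights_com = For ''i'' (For ''j'' (rcell_assign ''W'' ''i'' ''j''
     (RDiv (rabs (rcell ''S'' ''i'' ''j'')) (RSqrt (RMul (rcell ''S'' ''i'' ''i'') (rcell ''S'' ''j'' ''j''))))))"

lemma runs_weights:
  assumes p: "imem \<sigma> ''p'' 0 0 = n" and pos: "\<And>i. i < n \<Longrightarrow> 0 < rmem \<sigma> ''S'' i i"
  shows "runs n weights_com \<sigma> (\<lambda>\<tau>. \<forall>i<n. \<forall>j<n. rmem \<tau> ''W'' i j =
    \<bar>rmem \<sigma> ''S'' i j\<bar> / sqrt (rmem \<sigma> ''S'' i i * rmem \<sigma> ''S'' j j))"
  unfolding weights_com_def
proof (rule runs_For_pairs[where I = "\<lambda>R \<tau>. \<forall>(i, j)\<in>R. rmem \<tau> ''W'' i j =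
    \<bar>rmem \<sigma> ''S'' i j\<bar> / sqrt (rmem \<sigma> ''S'' i i * rmem \<sigma> ''S'' j j)", OF p], goal_cases)
  case (9 R i j \<tau>)
  have S: "rmem \<tau> ''S'' = rmem \<sigma> ''S''" using 9 by (simp add: frame_rmem)
  have "0 < rmem \<sigma> ''S'' i i * rmem \<sigma> ''S'' j j" using 9 pos by simp
  with 9 show ?case by (intro runs_RSet) (auto simp: S)
qed auto

definition min_weight_com :: com where
  "min_weight_com = Seq (rassign ''l'' (RGet ''W'' (INum 0) (INum 1)))
    (For ''i'' (For ''j'' (Cond (ILess (ivar ''i'') (ivar ''j''))
      (rassign ''l'' (rmin (rvar ''l'') (rcell ''W'' ''i'' ''j''))) Skip)))"

lemma runs_min_weight:
  assumes p: "imem \<sigma> ''p'' 0 0 = n" "n \<ge> 2"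
  shows "runs n min_weight_com \<sigma> (\<lambda>\<tau>. rmem \<tau> ''l'' 0 0 \<in> {rmem \<sigma> ''W'' i j | i j. i < j \<and> j < n} \<and>
    (\<forall>i j. i < j \<longrightarrow> j < n \<longrightarrow> rmem \<tau> ''l'' 0 0 \<le> rmem \<sigma> ''W'' i j))"
  unfolding min_weight_com_def
proof (intro runs_Seq runs_RSet, simp, rule runs_For_pairs[where I = "\<lambda>R \<tau>. rmem \<tau> ''l'' 0 0 \<in> {rmem \<sigma> ''W'' i j | i j. i < j \<and> j < n} \<and>
    (\<forall>(i, j)\<in>R. i < j \<longrightarrow> rmem \<tau> ''l'' 0 0 \<le> rmem \<sigma> ''W'' i j)"], goal_cases)
  case 9
  have "rmem \<sigma> ''W'' 0 1 \<in> {rmem \<sigma> ''W'' i j | i j. i < j \<and> j < n}" using p by fastforce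
  then show ?case by simp
next
  case (10 R i j \<tau>)
  then have W: "rmem \<tau> ''W'' = rmem \<sigma> ''W''" by (simp add: frame_rmem)
  define x where "x = rmem \<tau> ''l'' 0 0"
  have x: "x \<in> {rmem \<sigma> ''W'' i j | i j. i < j \<and> j < n}" "\<And>a b. (a, b) \<in> R \<Longrightarrow> a < b \<Longrightarrow> x \<le> rmem \<sigma> ''W'' a b"
    using 10 by (auto simp: x_def)
  show ?case
  proof (intro runs_Cond runs_RSet runs_Skip)
    assume "bval (ILess (ivar ''i'') (ivar ''j'')) \<tau>"
    then have "i < j" using 10 by simp
    then have "min x (rmem \<sigma> ''W'' i j) \<in> {rmem \<sigma> ''W'' i j | i j. i < j \<and> j < n}"
      using x(1) \<open>j < n\<close> by (cases "x \<le> rmem \<sigma> ''W'' i j") (simp only: min_absorb1, auto simp: min_def)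
    moreover have "min x (rmem \<sigma> ''W'' i j) \<le> rmem \<sigma> ''W'' a b" if "(a, b) \<in> insert (i, j) R" "a < b" for a b
      using that x(2)[of a b] by (auto intro: min.coboundedI1)
    ultimately show "rmem (rupdate ''l'' (ival (INum 0) \<tau>) (ival (INum 0) \<tau>)
         (rval (rmin (rvar ''l'') (rcell ''W'' ''i'' ''j'')) \<tau>) \<tau>) ''l'' 0 0
         \<in> {rmem \<sigma> ''W'' i j |i j. i < j \<and> j < n} \<and>
       (\<forall>(i, j)\<in>insert (i, j) R. i < j \<longrightarrow> rmem (rupdate ''l'' (ival (INum 0) \<tau>) (ival (INum 0) \<tau>)
         (rval (rmin (rvar ''l'') (rcell ''W'' ''i'' ''j'')) \<tau>) \<tau>) ''l'' 0 0 \<le> rmem \<sigma> ''W'' i j)"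
      using 10 by (simp add: W x_def[symmetric] Ball_def split: prod.split) 
  qed (use 10 in auto)
next
  case (11 \<tau>)
  then show ?case by auto
qed (use p in auto)

definition bottleneck_com :: com where
  "bottleneck_com = For ''k'' (For ''i'' (For ''j'' (rcell_assign ''W'' ''i'' ''j''
     (rmax (rcell ''W'' ''i'' ''j'') (rmin (rcell ''W'' ''i'' ''k'') (rcell ''W'' ''k'' ''j''))))))"

text \<open>
  The round is done in place: entries of row and column \<open>k\<close> that have already been rewritten have kept their
  values, by \<open>bottleneck_pivot\<close>.
\<close>

lemma runs_bottleneck:
  assumes p: "imem \<sigma> ''p'' 0 0 = n" and W: "\<And>i j. i < n \<Longrightarrow> j < n \<Longrightarrow> rmem \<sigma> ''W'' i j = W i j"
  shows "runs n bottleneck_com \<sigma> (\<lambda>\<tau>. \<forall>i<n. \<forall>j<n. rmem \<tau> ''W'' i j = bottleneck W n i j)"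
  unfolding bottleneck_com_def
proof (rule runs_For[where I = "\<lambda>k \<tau>. \<forall>i<n. \<forall>j<n. rmem \<tau> ''W'' i j = bottleneck W k i j", OF p], goal_cases)
  case (5 k \<tau>)
  have p\<tau>: "imem \<tau> ''p'' 0 0 = n" using 5 p by (simp add: frame_imem)
  show ?case
  proof (rule runs_For_pairs[where I = "\<lambda>R \<tau>. \<forall>i<n. \<forall>j<n. rmem \<tau> ''W'' i j =
      (if (i, j) \<in> R then bottleneck W (Suc k) i j else bottleneck W k i j)", OF p\<tau>], goal_cases)
    case (9 R i j \<tau>1)
    have k: "imem \<tau>1 ''k'' 0 0 = k" using 9 5 by (simp add: frame_imem)
    have "rmem \<tau>1 ''W'' i j = bottleneck W k i j" using 9 by simp
    moreover have "rmem \<tau>1 ''W'' i k = bottleneck W k i k"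
      using 9 5 bottleneck_pivot(1)[of W k i] by presburger
    moreover have "rmem \<tau>1 ''W'' k j = bottleneck W k k j"
      using 9 5 bottleneck_pivot(2)[of W k j] by presburger
    ultimately show ?case using 9 k by (intro runs_RSet) (auto simp: maxmin_step_def)
  qed (use 5 in auto)
qed (use W in auto)

text \<open>
  The quotient of the entries is stored in \<open>r\<close> before the row is changed, since the update of the column
  \<open>k\<close> sets its numerator to zero.
\<close>

definition eliminate_com :: com where
  "eliminate_com = Seq (rassign ''D'' (RNum 0)) (For ''k'' (Seq
    (rassign ''D'' (RAdd (rvar ''D'') (RLn (rcell ''A'' ''k'' ''k''))))
    (For ''i'' (Cond (ILess (ivar ''k'') (ivar ''i''))
      (Seq (rassign ''r'' (RDiv (rcell ''A'' ''i'' ''k'') (rcell ''A'' ''k'' ''k'')))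
        (For ''j'' (rcell_assign ''A'' ''i'' ''j''
          (RSub (rcell ''A'' ''i'' ''j'') (RMul (rvar ''r'') (rcell ''A'' ''k'' ''j''))))))
      Skip))))"

lemma writes_eliminate [simp]:
  "iwrites eliminate_com = {''k'', ''i'', ''j''}" "rwrites eliminate_com = {''D'', ''A'', ''r''}"
  "loop_depth eliminate_com = 3"
  by (auto simp: eliminate_com_def)

lemma runs_eliminate:
  assumes p: "imem \<sigma> ''p'' 0 0 = n" and A: "\<And>i j. i < n \<Longrightarrow> j < n \<Longrightarrow> rmem \<sigma> ''A'' i j = A i j"
    and pos: "pos_def_on n A"
  shows "runs n eliminate_com \<sigma> (\<lambda>\<tau>. rmem \<tau> ''D'' 0 0 = (\<Sum>k<n. ln (elim A k k k)))"
  unfolding eliminate_com_def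
proof (intro runs_Seq runs_RSet, simp, rule runs_For[where I = "\<lambda>k \<tau>. rmem \<tau> ''D'' 0 0 = (\<Sum>m<k. ln (elim A m m m)) \<and>
    (\<forall>i<n. \<forall>j<n. rmem \<tau> ''A'' i j = elim A k i j)"], goal_cases)
  case (6 k \<tau>)
  have p\<tau>: "imem \<tau> ''p'' 0 0 = n" using 6 p by (simp add: frame_imem)
  have piv: "0 < elim A k k k" using elim_pivot_pos[OF pos] 6 by simp
  let ?Akk = "RAdd (rvar ''D'') (RLn (rcell ''A'' ''k'' ''k''))"
  let ?\<tau> = "rupdate ''D'' 0 0 (\<Sum>m<Suc k. ln (elim A m m m)) \<tau>"
  have rows: "runs n (For ''i'' (Cond (ILess (ivar ''k'') (ivar ''i''))
      (Seq (rassign ''r'' (RDiv (rcell ''A'' ''i'' ''k'') (rcell ''A'' ''k'' ''k'')))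
        (For ''j'' (rcell_assign ''A'' ''i'' ''j''
          (RSub (rcell ''A'' ''i'' ''j'') (RMul (rvar ''r'') (rcell ''A'' ''k'' ''j''))))))
      Skip)) ?\<tau> (\<lambda>\<tau>'. rmem \<tau>' ''D'' 0 0 = (\<Sum>m<Suc k. ln (elim A m m m)) \<and>
    (\<forall>i<n. \<forall>j<n. rmem \<tau>' ''A'' i j = elim A (Suc k) i j))"
  proof (rule runs_For[where I = "\<lambda>i \<tau>. \<forall>a<n. \<forall>b<n. rmem \<tau> ''A'' a b =
      (if a < i then elim A (Suc k) a b else elim A k a b)"], goal_cases)
    case (6 i \<tau>1)
    note i = 6
    have k: "imem \<tau>1 ''k'' 0 0 = k" "imem \<tau>1 ''p'' 0 0 = n"
      using i \<open>imem \<tau> ''k'' 0 0 = k\<close> p\<tau> by (simp_all add: frame_imem)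
    have Ai: "rmem \<tau>1 ''A'' i j = elim A k i j" if "j < n" for j using i that by simp
    \<comment> \<open>Round \<open>k\<close> does not change row \<open>k\<close>, so it may be read whether or not its turn has passed.\<close>
    have Ak: "rmem \<tau>1 ''A'' k j = elim A k k j" if "j < n" for j
      using i that \<open>k < n\<close> by (simp add: elim_step_def)
    show ?case
    proof (rule runs_Cond)
      assume "\<not> bval (ILess (ivar ''k'') (ivar ''i'')) \<tau>1"
      then have "\<not> k < i" using i k by simp
      then show "runs n Skip \<tau>1 (\<lambda>\<tau>'. \<forall>a<n. \<forall>b<n. rmem (iupdate ''i'' 0 0 (Suc i) \<tau>') ''A'' a b =
          (if a < Suc i then elim A (Suc k) a b else elim A k a b))"
        using i by (intro runs_Skip) (auto simp: elim_step_def less_Suc_eq)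
    next
      assume "bval (ILess (ivar ''k'') (ivar ''i'')) \<tau>1"
      then have ki: "k < i" using i k by simp
      define r where "r = elim A k i k / elim A k k k"
      let ?\<tau>1 = "rupdate ''r'' 0 0 r \<tau>1"
      have "runs n (For ''j'' (rcell_assign ''A'' ''i'' ''j''
          (RSub (rcell ''A'' ''i'' ''j'') (RMul (rvar ''r'') (rcell ''A'' ''k'' ''j''))))) ?\<tau>1
        (\<lambda>\<tau>'. \<forall>a<n. \<forall>b<n. rmem (iupdate ''i'' 0 0 (Suc i) \<tau>') ''A'' a b =
          (if a < Suc i then elim A (Suc k) a b else elim A k a b))"
      proof (rule runs_For[where I = "\<lambda>j \<tau>. rmem \<tau> ''r'' 0 0 = r \<and> (\<forall>a<n. \<forall>b<n. rmem \<tau> ''A'' a b =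
          (if a < i \<or> a = i \<and> b < j then elim A (Suc k) a b else elim A k a b))"], goal_cases)
        case (6 j \<tau>2)
        have "imem \<tau>2 ''k'' 0 0 = k" "imem \<tau>2 ''i'' 0 0 = i"
          using 6 k i by (simp_all add: frame_imem)
        moreover have "rmem \<tau>2 ''A'' k j = elim A k k j"
          using 6 \<open>k < n\<close> by (simp add: elim_step_def)
        moreover have "rmem \<tau>2 ''A'' i j = elim A k i j"
          using 6 i by simp
        ultimately show ?case
          using 6 ki by (intro runs_RSet) (auto simp: elim_step_def r_def)
      next
        case 7
        then show ?case by (auto simp: less_Suc_eq)
      qed (use k i in auto)
      moreover have "rval (RDiv (rcell ''A'' ''i'' ''k'') (rcell ''A'' ''k'' ''k'')) \<tau>1 = r"
        using k i Ai Ak \<open>k < n\<close> by (simp add: r_def)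
      ultimately show "runs n (Seq (rassign ''r'' (RDiv (rcell ''A'' ''i'' ''k'') (rcell ''A'' ''k'' ''k'')))
        (For ''j'' (rcell_assign ''A'' ''i'' ''j''
          (RSub (rcell ''A'' ''i'' ''j'') (RMul (rvar ''r'') (rcell ''A'' ''k'' ''j'')))))) \<tau>1
        (\<lambda>\<tau>'. \<forall>a<n. \<forall>b<n. rmem (iupdate ''i'' 0 0 (Suc i) \<tau>') ''A'' a b =
          (if a < Suc i then elim A (Suc k) a b else elim A k a b))"
        using piv k i Ak \<open>k < n\<close> by (intro runs_Seq runs_RSet) auto
    qed simp
  next
    case (7 \<tau>1)
    then show ?case by (simp add: frame_rmem)
  qed (use 6 p\<tau> in auto)
  have "rval ?Akk \<tau> = (\<Sum>m<Suc k. ln (elim A m m m))" "rdefined ?Akk \<tau>"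
    using 6 piv by auto
  with rows show ?case
    by (intro runs_Seq runs_RSet) simp_all
qed (use p A in auto)

section \<open>The program that searches the thresholds\<close>

text \<open>
  Indices cannot be converted into reals, so \<open>p\<close> is obtained as a real number by counting.
\<close>

definition size_com :: com where
  "size_com = Seq (rassign ''P'' (RNum 0)) (For ''i'' (rassign ''P'' (RAdd (rvar ''P'') (RNum 1))))"

lemma runs_size:
  assumes "imem \<sigma> ''p'' 0 0 = n"
  shows "runs n size_com \<sigma> (\<lambda>\<tau>. rmem \<tau> ''P'' 0 0 = real n)"
  unfolding size_com_def
proof (intro runs_Seq runs_RSet, simp, rule runs_For[where I = "\<lambda>i \<tau>. rmem \<tau> ''P'' 0 0 = real i"], goal_cases)
  case (6 k \<tau>)
  then show ?case by (intro runs_RSet) auto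
qed (use assms in auto)

definition column_max_com :: com where
  "column_max_com = Seq (rassign ''u'' (rvar ''l'')) (For ''j'' (Cond (ILess (ivar ''j'') (ivar ''c''))
     (rassign ''u'' (rmax (rvar ''u'') (rcell ''W'' ''j'' ''c''))) Skip))"

lemma runs_column_max:
  assumes p: "imem \<sigma> ''p'' 0 0 = n" and c: "imem \<sigma> ''c'' 0 0 = c" "c < n"
    and W: "\<And>i j. i < n \<Longrightarrow> j < n \<Longrightarrow> rmem \<sigma> ''W'' i j = M i j"
  shows "runs n column_max_com \<sigma> (\<lambda>\<tau>. rmem \<tau> ''u'' 0 0 = column_max (rmem \<sigma> ''l'' 0 0) M c)"
  unfolding column_max_com_def
proof (intro runs_Seq runs_RSet, simp, rule runs_For[where I = "\<lambda>j \<tau>. rmem \<tau> ''u'' 0 0 =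
    Max (insert (rmem \<sigma> ''l'' 0 0) ((\<lambda>j. M j c) ` {..<min j c}))"], goal_cases)
  case (6 j \<tau>)
  let ?l = "rmem \<sigma> ''l'' 0 0"
  have mem: "imem \<tau> ''c'' 0 0 = c" "rmem \<tau> ''W'' = rmem \<sigma> ''W''"
    using 6 c by (simp_all add: frame_imem frame_rmem)
  show ?case
  proof (intro runs_Cond runs_RSet runs_Skip)
    assume "bval (ILess (ivar ''j'') (ivar ''c'')) \<tau>"
    then have j: "j < c" using 6 mem by simp
    then have "insert ?l ((\<lambda>j. M j c) ` {..<min (Suc j) c}) =
        insert (M j c) (insert ?l ((\<lambda>j. M j c) ` {..<min j c}))"
      by (auto simp: less_Suc_eq)
    then have "Max (insert ?l ((\<lambda>j. M j c) ` {..<min (Suc j) c})) =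
        max (M j c) (Max (insert ?l ((\<lambda>j. M j c) ` {..<min j c})))"
      by (simp del: Max_insert add: Max.insert[of "insert ?l ((\<lambda>j. M j c) ` {..<min j c})"])
    then show "rmem (iupdate ''j'' 0 0 (Suc j) (rupdate ''u'' (ival (INum 0) \<tau>) (ival (INum 0) \<tau>)
         (rval (rmax (rvar ''u'') (rcell ''W'' ''j'' ''c'')) \<tau>) \<tau>)) ''u'' 0 0 =
        Max (insert ?l ((\<lambda>j. M j c) ` {..<min (Suc j) c}))"
      using 6 mem c W by (simp add: max.commute)
  next
    assume "\<not> bval (ILess (ivar ''j'') (ivar ''c'')) \<tau>"
    then have "\<not> j < c" using 6 mem by simp
    then have "min (Suc j) c = min j c" by simp
    then show "rmem (iupdate ''j'' 0 0 (Suc j) \<tau>) ''u'' 0 0 =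
        Max (insert ?l ((\<lambda>j. M j c) ` {..<min (Suc j) c}))"
      using 6 by (simp only: mem_update)
  qed simp_all
next
  case (7 \<tau>)
  then show ?case using c by (simp add: column_max_def min_def)
qed (use p in auto)

definition same_class :: "name \<Rightarrow> bexp" where
  "same_class t = bor (IEq (ivar ''i'') (ivar ''j'')) (RLess (rvar t) (rcell ''W'' ''i'' ''j''))"

definition restrict_com :: com where
  "restrict_com = Seq (rassign ''N'' (RNum 0)) (For ''i'' (For ''j'' (Cond (same_class ''u'')
     (Seq (rcell_assign ''A'' ''i'' ''j'' (rcell ''S'' ''i'' ''j''))
       (rassign ''N'' (RAdd (rvar ''N'') (RNum 1))))
     (rcell_assign ''A'' ''i'' ''j'' (RNum 0)))))"

lemma runs_restrict:
  assumes p: "imem \<sigma> ''p'' 0 0 = n" and W: "\<And>i j. i < n \<Longrightarrow> j < n \<Longrightarrow> rmem \<sigma> ''W'' i j = M i j"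
    and u: "rmem \<sigma> ''u'' 0 0 = u"
  shows "runs n restrict_com \<sigma> (\<lambda>\<tau>.
    (\<forall>i<n. \<forall>j<n. rmem \<tau> ''A'' i j = (if i = j \<or> u < M i j then rmem \<sigma> ''S'' i j else 0)) \<and>
    rmem \<tau> ''N'' 0 0 = real (card {(i, j). i < n \<and> j < n \<and> (i = j \<or> u < M i j)}))"
  unfolding restrict_com_def
proof (intro runs_Seq runs_RSet, simp, rule runs_For_pairs[where I = "\<lambda>R \<tau>. R \<subseteq> {..<n} \<times> {..<n} \<and>
    (\<forall>(i, j)\<in>R. rmem \<tau> ''A'' i j = (if i = j \<or> u < M i j then rmem \<sigma> ''S'' i j else 0)) \<and>
    rmem \<tau> ''N'' 0 0 = real (card {(i, j). (i, j) \<in> R \<and> (i = j \<or> u < M i j)})"], goal_cases)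
  case (10 R i j \<tau>)
  let ?K = "\<lambda>R. {(i, j). (i, j) \<in> R \<and> (i = j \<or> u < M i j)}"
  have mem: "rmem \<tau> ''u'' 0 0 = u" "rmem \<tau> ''W'' = rmem \<sigma> ''W''" "rmem \<tau> ''S'' = rmem \<sigma> ''S''"
    using 10 u by (simp_all add: frame_rmem)
  have fin: "finite (?K R)"
    using 10 by (intro finite_subset[of "?K R" "{..<n} \<times> {..<n}"]) auto
  have bval: "bval (same_class ''u'') \<tau> \<longleftrightarrow> i = j \<or> u < M i j"
    using 10 mem W by (simp add: same_class_def)
  show ?case
  proof (rule runs_Cond)
    assume "bval (same_class ''u'') \<tau>"
    then have r: "i = j \<or> u < M i j" using bval by simp
    then have "?K (insert (i, j) R) = insert (i, j) (?K R)" by auto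
    then have "card (?K (insert (i, j) R)) = Suc (card (?K R))"
      using fin \<open>(i, j) \<notin> R\<close> by simp
    with r show "runs n (Seq (rcell_assign ''A'' ''i'' ''j'' (rcell ''S'' ''i'' ''j''))
       (rassign ''N'' (RAdd (rvar ''N'') (RNum 1)))) \<tau> (\<lambda>\<tau>'. insert (i, j) R \<subseteq> {..<n} \<times> {..<n} \<and>
      (\<forall>(i, j)\<in>insert (i, j) R. rmem \<tau>' ''A'' i j = (if i = j \<or> u < M i j then rmem \<sigma> ''S'' i j else 0)) \<and>
      rmem \<tau>' ''N'' 0 0 = real (card (?K (insert (i, j) R))))"
      using 10 mem by (intro runs_Seq runs_RSet) auto
  next
    assume "\<not> bval (same_class ''u'') \<tau>"
    then have r: "\<not> (i = j \<or> u < M i j)" using bval by simp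
    then have "?K (insert (i, j) R) = ?K R" by auto
    with r show "runs n (rcell_assign ''A'' ''i'' ''j'' (RNum 0)) \<tau> (\<lambda>\<tau>'. insert (i, j) R \<subseteq> {..<n} \<times> {..<n} \<and>
      (\<forall>(i, j)\<in>insert (i, j) R. rmem \<tau>' ''A'' i j = (if i = j \<or> u < M i j then rmem \<sigma> ''S'' i j else 0)) \<and>
      rmem \<tau>' ''N'' 0 0 = real (card (?K (insert (i, j) R))))"
      using 10 mem by (intro runs_RSet) auto
  qed (simp add: same_class_def)
next
  case (11 \<tau>)
  then show ?case by simp
qed (use p in auto)

definition score_com :: com where
  "score_com = Seq column_max_com (Seq restrict_com (Seq eliminate_com
     (rassign ''f'' (RAdd (rvar ''D'') (RMul (RMul (rvar ''P'') (rvar ''kappa'')) (rvar ''N''))))))"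

text \<open>
  At the first threshold the cell \<open>best\<close> still holds an arbitrary value, so there the outcome of
  the comparison is overridden.
\<close>

definition search_com :: com where
  "search_com = For ''c'' (Seq score_com
     (Cond (bor (IEq (ivar ''c'') (INum 0)) (RLess (rvar ''f'') (rvar ''best'')))
       (Seq (rassign ''best'' (rvar ''f'')) (rassign ''t'' (rvar ''u''))) Skip))"

text \<open>
  Each equivalent \<open>j\<close> overwrites the label of \<open>i\<close>, so the largest one remains.
\<close>

definition label_com :: com where
  "label_com = For ''i'' (For ''j'' (Cond (same_class ''t'')
     (ISet ''B'' (ivar ''i'') (INum 0) (ivar ''j'')) Skip))"

lemma writes_column_max [simp]:
  "iwrites column_max_com = {''j''}" "rwrites column_max_com = {''u''}"
  by (auto simp: column_max_com_def)

lemma writes_restrict [simp]: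
  "iwrites restrict_com = {''i'', ''j''}" "rwrites restrict_com = {''N'', ''A''}"
  by (auto simp: restrict_com_def)

lemma writes_score [simp]:
  "iwrites score_com = {''i'', ''j'', ''k''}" "rwrites score_com = {''u'', ''N'', ''A'', ''D'', ''r'', ''f''}"
  by (auto simp: score_com_def)

text \<open>
  The set of equivalent indices seen so far may be empty until \<open>j\<close> reaches \<open>i\<close>, and before that the cell may
  hold an arbitrary initial value.
\<close>

lemma runs_label:
  assumes p: "imem \<sigma> ''p'' 0 0 = n" and W: "\<And>i j. i < n \<Longrightarrow> j < n \<Longrightarrow> rmem \<sigma> ''W'' i j = M i j"
    and t: "rmem \<sigma> ''t'' 0 0 = u"
  shows "runs n label_com \<sigma> (\<lambda>\<tau>. \<forall>i<n. imem \<tau> ''B'' i 0 = Max {j. j < n \<and> (i = j \<or> u < M i j)})"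
  unfolding label_com_def
proof (rule runs_For[where I = "\<lambda>i \<tau>. \<forall>a<i. imem \<tau> ''B'' a 0 = Max {j. j < n \<and> (a = j \<or> u < M a j)}", OF p], goal_cases)
  case (5 i \<tau>)
  have p\<tau>: "imem \<tau> ''p'' 0 0 = n" using 5 p by (simp add: frame_imem)
  let ?L = "\<lambda>j. {b. b < j \<and> (i = b \<or> u < M i b)}"
  show ?case
  proof (rule runs_For[where I = "\<lambda>j \<tau>. (\<forall>a<i. imem \<tau> ''B'' a 0 = Max {j. j < n \<and> (a = j \<or> u < M a j)}) \<and>
      (?L j \<noteq> {} \<longrightarrow> imem \<tau> ''B'' i 0 = Max (?L j))", OF p\<tau>], goal_cases)
    case (5 j \<tau>1)
    have mem: "imem \<tau>1 ''i'' 0 0 = i" "rmem \<tau>1 ''t'' 0 0 = u" "rmem \<tau>1 ''W'' = rmem \<sigma> ''W''"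
      using 5 \<open>frame _ \<sigma> \<tau>\<close> \<open>imem \<tau> ''i'' 0 0 = i\<close> t by (simp_all add: frame_imem frame_rmem)
    have bval: "bval (same_class ''t'') \<tau>1 \<longleftrightarrow> i = j \<or> u < M i j"
      using 5 mem W \<open>i < n\<close> by (simp add: same_class_def)
    show ?case
    proof (intro runs_Cond runs_ISet runs_Skip)
      assume "bval (same_class ''t'') \<tau>1"
      then have "Max (?L (Suc j)) = j"
        using bval by (intro Max_eqI) auto
      then show "(\<forall>a<i. imem (iupdate ''j'' 0 0 (Suc j)
            (iupdate ''B'' (ival (ivar ''i'') \<tau>1) (ival (INum 0) \<tau>1) (ival (ivar ''j'') \<tau>1) \<tau>1)) ''B'' a 0 =
            Max {j. j < n \<and> (a = j \<or> u < M a j)}) \<and>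
          (?L (Suc j) \<noteq> {} \<longrightarrow> imem (iupdate ''j'' 0 0 (Suc j)
            (iupdate ''B'' (ival (ivar ''i'') \<tau>1) (ival (INum 0) \<tau>1) (ival (ivar ''j'') \<tau>1) \<tau>1)) ''B'' i 0 =
            Max (?L (Suc j)))"
        using 5 mem by simp
    next
      assume "\<not> bval (same_class ''t'') \<tau>1"
      then have "?L (Suc j) = ?L j" using bval by (auto simp: less_Suc_eq)
      with 5 show "(\<forall>a<i. imem (iupdate ''j'' 0 0 (Suc j) \<tau>1) ''B'' a 0 =
            Max {j. j < n \<and> (a = j \<or> u < M a j)}) \<and>
          (?L (Suc j) \<noteq> {} \<longrightarrow> imem (iupdate ''j'' 0 0 (Suc j) \<tau>1) ''B'' i 0 = Max (?L (Suc j)))"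
        by simp
    qed (simp add: same_class_def)
  next
    case (6 \<tau>1)
    \<comment> \<open>At the end of the inner loop the set of equivalent indices contains \<open>i\<close>, so the label is defined.\<close>
    moreover have "i \<in> ?L n" using \<open>i < n\<close> by simp
    ultimately show ?case by (auto simp: less_Suc_eq)
  qed (use 5 in auto)
qed auto

definition select_com :: com where
  "select_com = Seq weights_com (Seq min_weight_com (Seq bottleneck_com (Seq size_com
     (Seq search_com label_com))))"

lemma loop_depth_select: "loop_depth select_com = 4"
  by (simp add: select_com_def weights_com_def min_weight_com_def bottleneck_com_def size_com_def
    search_com_def label_com_def score_com_def column_max_com_def restrict_com_def)

context covariance
begin

lemma runs_score:
  assumes mem: "imem \<sigma> ''p'' 0 0 = p" "rmem \<sigma> ''l'' 0 0 = wmin" "rmem \<sigma> ''P'' 0 0 = real p"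
      "rmem \<sigma> ''kappa'' 0 0 = \<kappa>"
    and W: "\<And>i j. i < p \<Longrightarrow> j < p \<Longrightarrow> rmem \<sigma> ''W'' i j = M i j"
    and S: "\<And>i j. i < p \<Longrightarrow> j < p \<Longrightarrow> rmem \<sigma> ''S'' i j = S $$ (i, j)"
    and c: "imem \<sigma> ''c'' 0 0 = c" "c < p"
  shows "runs p score_com \<sigma> (\<lambda>\<tau>. rmem \<tau> ''u'' 0 0 = threshold c \<and>
    rmem \<tau> ''f'' 0 0 = score \<kappa> (threshold c))"
  unfolding score_com_def
proof (rule runs_Seq, rule runs_mono[OF runs_column_max[OF mem(1) c W]])
  fix \<tau>1
  assume fr1: "frame column_max_com \<sigma> \<tau>1"
    and u1: "rmem \<tau>1 ''u'' 0 0 = column_max (rmem \<sigma> ''l'' 0 0) M c"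
  then have u: "rmem \<tau>1 ''u'' 0 0 = threshold c" using mem by simp
  have p1: "imem \<tau>1 ''p'' 0 0 = p" using fr1 mem by (simp add: frame_imem)
  have W1: "rmem \<tau>1 ''W'' i j = M i j" if "i < p" "j < p" for i j
    using fr1 W that by (simp add: frame_rmem)
  show "runs p (Seq restrict_com (Seq eliminate_com
     (rassign ''f'' (RAdd (rvar ''D'') (RMul (RMul (rvar ''P'') (rvar ''kappa'')) (rvar ''N'')))))) \<tau>1
     (\<lambda>\<tau>. rmem \<tau> ''u'' 0 0 = threshold c \<and> rmem \<tau> ''f'' 0 0 = score \<kappa> (threshold c))"
  proof (rule runs_Seq, rule runs_mono[OF runs_restrict[OF p1 W1 u]])
    fix \<tau>2
    assume fr2: "frame restrict_com \<tau>1 \<tau>2"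
      and AN: "(\<forall>i<p. \<forall>j<p. rmem \<tau>2 ''A'' i j =
          (if i = j \<or> threshold c < M i j then rmem \<tau>1 ''S'' i j else 0)) \<and>
        rmem \<tau>2 ''N'' 0 0 = real (card {(i, j). i < p \<and> j < p \<and> (i = j \<or> threshold c < M i j)})"
    have p2: "imem \<tau>2 ''p'' 0 0 = p" using fr2 p1 by (simp add: frame_imem)
    have A: "rmem \<tau>2 ''A'' i j = blocks (threshold c) i j" if "i < p" "j < p" for i j
      using AN that fr1 S by (simp add: blocks_def frame_rmem)
    show "runs p (Seq eliminate_com
       (rassign ''f'' (RAdd (rvar ''D'') (RMul (RMul (rvar ''P'') (rvar ''kappa'')) (rvar ''N''))))) \<tau>2
       (\<lambda>\<tau>. rmem \<tau> ''u'' 0 0 = threshold c \<and> rmem \<tau> ''f'' 0 0 = score \<kappa> (threshold c))"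
    proof (rule runs_Seq, rule runs_mono[OF runs_eliminate[OF p2 A blocks_pos]])
      fix \<tau>3
      assume fr3: "frame eliminate_com \<tau>2 \<tau>3"
        and D: "rmem \<tau>3 ''D'' 0 0 = (\<Sum>k<p. ln (elim (blocks (threshold c)) k k k))"
      have "rmem \<tau>3 ''u'' 0 0 = threshold c" "rmem \<tau>3 ''P'' 0 0 = real p"
        "rmem \<tau>3 ''kappa'' 0 0 = \<kappa>" "rmem \<tau>3 ''N'' = rmem \<tau>2 ''N''"
        using fr1 fr2 fr3 u mem by (simp_all add: frame_rmem)
      then show "runs p (rassign ''f'' (RAdd (rvar ''D'') (RMul (RMul (rvar ''P'') (rvar ''kappa'')) (rvar ''N'')))) \<tau>3
         (\<lambda>\<tau>. rmem \<tau> ''u'' 0 0 = threshold c \<and> rmem \<tau> ''f'' 0 0 = score \<kappa> (threshold c))"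
        using AN D by (intro runs_RSet) (simp_all add: score_def)
    qed
  qed
qed

lemma runs_search:
  assumes mem: "imem \<sigma> ''p'' 0 0 = p" "rmem \<sigma> ''l'' 0 0 = wmin" "rmem \<sigma> ''P'' 0 0 = real p"
      "rmem \<sigma> ''kappa'' 0 0 = \<kappa>"
    and W: "\<And>i j. i < p \<Longrightarrow> j < p \<Longrightarrow> rmem \<sigma> ''W'' i j = M i j"
    and S: "\<And>i j. i < p \<Longrightarrow> j < p \<Longrightarrow> rmem \<sigma> ''S'' i j = S $$ (i, j)"
  shows "runs p search_com \<sigma> (\<lambda>\<tau>. \<exists>c<p. rmem \<tau> ''t'' 0 0 = threshold c \<and>
    (\<forall>d<p. score \<kappa> (threshold c) \<le> score \<kappa> (threshold d)))"
  unfolding search_com_def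
proof (rule runs_For[where I = "\<lambda>k \<tau>. k = 0 \<or> (\<exists>c<k. rmem \<tau> ''t'' 0 0 = threshold c \<and>
    rmem \<tau> ''best'' 0 0 = score \<kappa> (threshold c) \<and>
    (\<forall>d<k. score \<kappa> (threshold c) \<le> score \<kappa> (threshold d)))", OF mem(1)], goal_cases)
  case (5 k \<tau>)
  let ?Q = "\<lambda>\<tau>'. Suc k = 0 \<or> (\<exists>c<Suc k. rmem (iupdate ''c'' 0 0 (Suc k) \<tau>') ''t'' 0 0 = threshold c \<and>
    rmem (iupdate ''c'' 0 0 (Suc k) \<tau>') ''best'' 0 0 = score \<kappa> (threshold c) \<and>
    (\<forall>d<Suc k. score \<kappa> (threshold c) \<le> score \<kappa> (threshold d)))"
  have "runs p score_com \<tau> (\<lambda>\<tau>. rmem \<tau> ''u'' 0 0 = threshold k \<and>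
    rmem \<tau> ''f'' 0 0 = score \<kappa> (threshold k))"
    by (rule runs_score) (use 5 mem W S in \<open>simp_all add: frame_imem frame_rmem\<close>)
  then show ?case
  proof (rule runs_Seq[OF runs_mono], intro runs_Cond)
    fix \<tau>1
    assume fr: "frame score_com \<tau> \<tau>1"
      and uf: "rmem \<tau>1 ''u'' 0 0 = threshold k \<and> rmem \<tau>1 ''f'' 0 0 = score \<kappa> (threshold k)"
    let ?b = "bor (IEq (ivar ''c'') (INum 0)) (RLess (rvar ''f'') (rvar ''best''))"
    have mem1: "imem \<tau>1 ''c'' 0 0 = k" "rmem \<tau>1 ''t'' = rmem \<tau> ''t''" "rmem \<tau>1 ''best'' = rmem \<tau> ''best''"
      using fr 5 by (simp_all add: frame_imem frame_rmem)
    show "runs p (Seq (rassign ''best'' (rvar ''f'')) (rassign ''t'' (rvar ''u''))) \<tau>1 ?Q" if "bval ?b \<tau>1"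
    proof -
      have "score \<kappa> (threshold k) \<le> score \<kappa> (threshold d)" if "d < Suc k" for d
        using \<open>bval ?b \<tau>1\<close> 5(4) uf mem1 that by (fastforce simp: less_Suc_eq)
      then show ?thesis
        using uf by (intro runs_Seq runs_RSet) (auto intro!: exI[of _ k])
    qed
    show "runs p Skip \<tau>1 ?Q" if "\<not> bval ?b \<tau>1"
    proof -
      from that 5(4) mem1 obtain c where "c < k" "rmem \<tau>1 ''t'' 0 0 = threshold c"
        "rmem \<tau>1 ''best'' 0 0 = score \<kappa> (threshold c)"
        "\<forall>d<k. score \<kappa> (threshold c) \<le> score \<kappa> (threshold d)" by auto
      then show ?thesis
        using that uf by (intro runs_Skip) (auto simp: less_Suc_eq intro!: exI[of _ c])
    qed
  qed simp
qed (use p in auto)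

lemma runs_select:
  assumes input: "holds_input \<sigma> p S \<kappa>"
  shows "runs p select_com \<sigma> (\<lambda>\<tau>. \<exists>c<p. output_partition \<tau> p = level_classes p M (threshold c) \<and>
    (\<forall>d<p. score \<kappa> (threshold c) \<le> score \<kappa> (threshold d)))"
proof -
  let ?Q = "\<lambda>\<tau>. \<exists>c<p. output_partition \<tau> p = level_classes p M (threshold c) \<and>
    (\<forall>d<p. score \<kappa> (threshold c) \<le> score \<kappa> (threshold d))"
  have p0: "imem \<sigma> ''p'' 0 0 = p" and kappa0: "rmem \<sigma> ''kappa'' 0 0 = \<kappa>"
    and S0: "\<And>i j. i < p \<Longrightarrow> j < p \<Longrightarrow> rmem \<sigma> ''S'' i j = S $$ (i, j)"
    using input by (auto simp: holds_input_def)
  have pos: "0 < rmem \<sigma> ''S'' i i" if "i < p" for i using S0 S_diag that by simp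
  note frames = frame_imem frame_rmem
  show ?thesis
    unfolding select_com_def
  proof (rule runs_Seq, rule runs_mono[OF runs_weights[OF p0 pos]])
    fix \<tau>1
    assume fr1: "frame weights_com \<sigma> \<tau>1"
      and "\<forall>i<p. \<forall>j<p. rmem \<tau>1 ''W'' i j = \<bar>rmem \<sigma> ''S'' i j\<bar> / sqrt (rmem \<sigma> ''S'' i i * rmem \<sigma> ''S'' j j)"
    then have W1: "rmem \<tau>1 ''W'' i j = W i j" if "i < p" "j < p" for i j
      using that S0 by (simp add: W_def)
    have mem1: "imem \<tau>1 ''p'' 0 0 = p" "rmem \<tau>1 ''kappa'' = rmem \<sigma> ''kappa''" "rmem \<tau>1 ''S'' = rmem \<sigma> ''S''"
      using fr1 p0 by (simp_all add: weights_com_def frames)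
    show "runs p (Seq min_weight_com (Seq bottleneck_com (Seq size_com (Seq search_com label_com)))) \<tau>1 ?Q"
    proof (rule runs_Seq, rule runs_mono[OF runs_min_weight[OF mem1(1) p]])
      fix \<tau>2
      assume fr2: "frame min_weight_com \<tau>1 \<tau>2"
        and l: "rmem \<tau>2 ''l'' 0 0 \<in> {rmem \<tau>1 ''W'' i j | i j. i < j \<and> j < p} \<and>
          (\<forall>i j. i < j \<longrightarrow> j < p \<longrightarrow> rmem \<tau>2 ''l'' 0 0 \<le> rmem \<tau>1 ''W'' i j)"
      obtain i j where "i < j" "j < p" "rmem \<tau>2 ''l'' 0 0 = W i j"
        using l W1 by (auto dest: less_trans)
      then have l2: "rmem \<tau>2 ''l'' 0 0 = wmin"
        using l W1 by (intro wminI) auto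
      have mem2: "imem \<tau>2 ''p'' 0 0 = p" "rmem \<tau>2 ''kappa'' = rmem \<sigma> ''kappa''" "rmem \<tau>2 ''S'' = rmem \<sigma> ''S''"
        "rmem \<tau>2 ''W'' = rmem \<tau>1 ''W''"
        using fr2 mem1 by (simp_all add: min_weight_com_def frames)
      have W2: "rmem \<tau>2 ''W'' i j = W i j" if "i < p" "j < p" for i j
        using W1 mem2 that by simp
      show "runs p (Seq bottleneck_com (Seq size_com (Seq search_com label_com))) \<tau>2 ?Q"
      proof (rule runs_Seq, rule runs_mono[OF runs_bottleneck[OF mem2(1) W2]])
        fix \<tau>3
        assume fr3: "frame bottleneck_com \<tau>2 \<tau>3" and W3: "\<forall>i<p. \<forall>j<p. rmem \<tau>3 ''W'' i j = M i j"
        have mem3: "imem \<tau>3 ''p'' 0 0 = p" "rmem \<tau>3 ''kappa'' = rmem \<sigma> ''kappa''" "rmem \<tau>3 ''S'' = rmem \<sigma> ''S''"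
          "rmem \<tau>3 ''l'' 0 0 = wmin"
          using fr3 mem2 l2 by (simp_all add: bottleneck_com_def frames)
        show "runs p (Seq size_com (Seq search_com label_com)) \<tau>3 ?Q"
        proof (rule runs_Seq, rule runs_mono[OF runs_size[OF mem3(1)]])
          fix \<tau>4
          assume fr4: "frame size_com \<tau>3 \<tau>4" and P4: "rmem \<tau>4 ''P'' 0 0 = real p"
          have mem4: "imem \<tau>4 ''p'' 0 0 = p" "rmem \<tau>4 ''kappa'' 0 0 = \<kappa>" "rmem \<tau>4 ''S'' = rmem \<sigma> ''S''"
            "rmem \<tau>4 ''l'' 0 0 = wmin" "rmem \<tau>4 ''W'' = rmem \<tau>3 ''W''"
            using fr4 mem3 kappa0 by (simp_all add: size_com_def frames)
          have S4: "rmem \<tau>4 ''S'' i j = S $$ (i, j)" "rmem \<tau>4 ''W'' i j = M i j" if "i < p" "j < p" for i j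
            using that S0 W3 mem4 by simp_all
          show "runs p (Seq search_com label_com) \<tau>4 ?Q"
          proof (rule runs_Seq, rule runs_mono[OF runs_search[OF mem4(1,4) P4 mem4(2) S4(2,1)]])
            fix \<tau>5
            assume fr5: "frame search_com \<tau>4 \<tau>5"
              and "\<exists>c<p. rmem \<tau>5 ''t'' 0 0 = threshold c \<and>
                (\<forall>d<p. score \<kappa> (threshold c) \<le> score \<kappa> (threshold d))"
            then obtain c where c: "c < p" "rmem \<tau>5 ''t'' 0 0 = threshold c"
              "\<forall>d<p. score \<kappa> (threshold c) \<le> score \<kappa> (threshold d)" by blast
            have p5: "imem \<tau>5 ''p'' 0 0 = p" and W5: "rmem \<tau>5 ''W'' = rmem \<tau>4 ''W''"
              using fr5 mem4 by (simp_all add: search_com_def frames)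
            have W5': "rmem \<tau>5 ''W'' i j = M i j" if "i < p" "j < p" for i j
              using W5 S4 that by simp
            show "runs p label_com \<tau>5 ?Q"
            proof (rule runs_mono[OF runs_label[OF p5 W5' c(2)]])
              fix \<tau> :: store
              assume "\<forall>i<p. imem \<tau> ''B'' i 0 = Max {j. j < p \<and> (i = j \<or> threshold c < M i j)}"
              then have "output_partition \<tau> p = level_classes p M (threshold c)"
                unfolding output_partition_def by (intro label_level_classes) simp
              with c show "?Q \<tau>" by blast
            qed
          qed
        qed
      qed
    qed
  qed
qed

end

theorem proposition4:
  shows "\<exists>(prog :: com) (T :: nat \<Rightarrow> nat).
    (\<lambda>p. real (T p)) \<in> O(\<lambda>p. real p ^ 4) \<and>
    (\<forall>(p :: nat) (n :: nat) (X :: nat \<Rightarrow> real vec) (S :: real mat) (\<kappa> :: real) (\<sigma> :: store).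
       p \<ge> 2 \<longrightarrow>
       (\<forall>l\<in>{1..n}. X l \<in> carrier_vec p) \<longrightarrow>
       S = empirical_covariance p n X \<longrightarrow>
       positive_definite S \<longrightarrow>
       \<kappa> \<ge> 0 \<longrightarrow>
       holds_input \<sigma> p S \<kappa> \<longrightarrow>
       (\<exists>t \<tau>. exec prog \<sigma> t \<tau> \<and> t \<le> T p \<and>
          is_arg_min (Psi \<kappa> S)
            (\<lambda>B. B \<in> threshold_partition (correlation S) ` thresholds (correlation S))
            (output_partition \<tau> p)))"
proof (rule exI[of _ select_com], rule exI[of _ "\<lambda>p. bound p select_com"], intro conjI allI impI)
  show "(\<lambda>p. real (bound p select_com)) \<in> O(\<lambda>p. real p ^ 4)"
    using bound_bigo[of select_com] by (simp add: loop_depth_select)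
next
  fix p n X \<kappa> \<sigma> and S :: "real mat"
  assume p: "p \<ge> 2" and S: "S = empirical_covariance p n X" and pd: "positive_definite S"
    and input: "holds_input \<sigma> p S \<kappa>"
  interpret covariance p S
    by unfold_locales (use p S pd in \<open>auto simp: empirical_covariance_def\<close>)
  obtain t \<tau> c where run: "exec select_com \<sigma> t \<tau>" "t \<le> bound p select_com" and c: "c < p"
    and out: "output_partition \<tau> p = level_classes p M (threshold c)"
    and best: "\<forall>d<p. score \<kappa> (threshold c) \<le> score \<kappa> (threshold d)"
    using runs_select[OF input] unfolding runs_def by blast
  have "is_arg_min (Psi \<kappa> S)
      (\<lambda>B. B \<in> threshold_partition (correlation S) ` thresholds (correlation S)) (output_partition \<tau> p)"
    unfolding out using c best by (intro is_arg_min_level_classes) auto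
  with run show "\<exists>t \<tau>. exec select_com \<sigma> t \<tau> \<and> t \<le> bound p select_com \<and>
      is_arg_min (Psi \<kappa> S)
        (\<lambda>B. B \<in> threshold_partition (correlation S) ` thresholds (correlation S)) (output_partition \<tau> p)"
    by blast
qed

end
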